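(* Let $V(z)=\sum_{j=1}^{2d}v_jz^j$ with $v_{2d}>0$, and for $t\ge1$ let $V(z;t)=(1-t^{-1})z^2+V(t^{-1/2}z)$, with free energy $F_N(t)=-N^{-2}\ln Z_N(t)$, $Z_N(t)=\int_{\mathbb R^N}\prod_{j<k}(z_j-z_k)^2e^{-N\sum_jV(z_j;t)}dz$. Then for $t\ge1$ $$F_N(t)=F_N^{\mathrm{Gauss}}+\int_t^\infty\frac{t-\tau}{\tau^2}\Big\{\gamma_N^2(\tau)\big[\gamma_{N-1}^2(\tau)+\gamma_{N+1}^2(\tau)+\beta_N^2(\tau)+2\beta_N(\tau)\beta_{N-1}(\tau)+\beta_{N-1}^2(\tau)\big]-\frac12\Big\}d\tau,$$ where $\gamma_n(\tau),\beta_n(\tau)$ ($n=N-1,N,N+1$) are the recurrence coefficients for the weight $e^{-NV(z;\tau)}$, and $$F_N^{\mathrm{Gauss}}=-\frac1{N^2}\ln\Big(\frac{(2\pi)^{N/2}}{(2N)^{N^2/2}}\prod_{n=1}^Nn!\Big)$$ is the free energy of the Gaussian ensemble (the integral converges).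
   Context: Recurrence coefficients for a weight $e^{-NU(z)}$: with $P_n(z)=z^n+\dots$ monic orthogonal polynomials on $\mathbb R$ and $h_n=\int P_n^2e^{-NU}dz$, $zP_n=P_{n+1}+\beta_nP_n+\gamma_n^2P_{n-1}$, $\gamma_n=\sqrt{h_n/h_{n-1}}>0$. *)

theory Defs
  imports "HOL-Analysis.Analysis" "HOL-Computational_Algebra.Polynomial"
begin

definition Vpot :: "(nat \<Rightarrow> real) \<Rightarrow> nat \<Rightarrow> real \<Rightarrow> real" where
  "Vpot v d z = (\<Sum>j=1..2*d. v j * z ^ j)"

definition Vdef :: "(nat \<Rightarrow> real) \<Rightarrow> nat \<Rightarrow> real \<Rightarrow> real \<Rightarrow> real" where
  "Vdef v d t z = (1 - 1 / t) * z ^ 2 + Vpot v d (z / sqrt t)"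

definition ZN :: "(nat \<Rightarrow> real) \<Rightarrow> nat \<Rightarrow> nat \<Rightarrow> real \<Rightarrow> real" where
  "ZN v d N t = integral\<^sup>L (Pi\<^sub>M {..<N} (\<lambda>_. lborel))
     (\<lambda>z. (\<Prod>k<N. \<Prod>j<k. (z j - z k) ^ 2) * exp (- real N * (\<Sum>j<N. Vdef v d t (z j))))"

definition FN :: "(nat \<Rightarrow> real) \<Rightarrow> nat \<Rightarrow> nat \<Rightarrow> real \<Rightarrow> real" where
  "FN v d N t = - ln (ZN v d N t) / (real N) ^ 2"

definition monic_OP :: "(real \<Rightarrow> real) \<Rightarrow> nat \<Rightarrow> real poly" where
  "monic_OP w n = (THE p. degree p = n \<and> lead_coeff p = 1 \<and>
      (\<forall>k<n. (LINT x|lborel. poly p x * x ^ k * w x) = 0))"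

definition hOP :: "(real \<Rightarrow> real) \<Rightarrow> nat \<Rightarrow> real" where
  "hOP w n = (LINT x|lborel. (poly (monic_OP w n) x)\<^sup>2 * w x)"

text \<open>gamma_n = sqrt(h_n / h_{n-1}) for n >= 1 (convention gamma_0 = 0, i.e. P_{-1} = 0).\<close>
definition gammaOP :: "(real \<Rightarrow> real) \<Rightarrow> nat \<Rightarrow> real" where
  "gammaOP w n = (if n = 0 then 0 else sqrt (hOP w n / hOP w (n - 1)))"

definition betaOP :: "(real \<Rightarrow> real) \<Rightarrow> nat \<Rightarrow> real" where
  "betaOP w n = (THE b. [:0, 1:] * monic_OP w n =
      monic_OP w (Suc n) + smult b (monic_OP w n)
      + smult ((gammaOP w n)\<^sup>2) (if n = 0 then 0 else monic_OP w (n - 1)))"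

definition weight :: "(nat \<Rightarrow> real) \<Rightarrow> nat \<Rightarrow> nat \<Rightarrow> real \<Rightarrow> real \<Rightarrow> real" where
  "weight v d N t z = exp (- real N * Vdef v d t z)"

definition FGauss :: "nat \<Rightarrow> real" where
  "FGauss N = - ln ((2 * pi) powr (real N / 2) / (2 * real N) powr ((real N)\<^sup>2 / 2)
       * (\<Prod>n=1..N. fact n)) / (real N)\<^sup>2"

definition integrand :: "(nat \<Rightarrow> real) \<Rightarrow> nat \<Rightarrow> nat \<Rightarrow> real \<Rightarrow> real \<Rightarrow> real" where
  "integrand v d N t \<tau> =
     (let w = weight v d N \<tau>; g = gammaOP w; b = betaOP w in
      (t - \<tau>) / \<tau>\<^sup>2 * ((g N)\<^sup>2 * ((g (N - 1))\<^sup>2 + (g (N + 1))\<^sup>2 + (b N)\<^sup>2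
          + 2 * b N * b (N - 1) + (b (N - 1))\<^sup>2) - 1 / 2))"

end

theory Submission
  imports Defs "HOL-Probability.Distributions" "Jordan_Normal_Form.Determinant"
begin

text \<open>
  In the variable \<open>u = z / sqrt \<tau>\<close> the weight becomes \<open>exp (- N (s u\<^sup>2 + V u))\<close> with \<open>s = \<tau> - 1\<close>, so that
  its moments satisfy \<open>\<mu>\<^sub>k' = - N \<mu>\<^sub>k\<^sub>+\<^sub>2\<close>. Heine's formula gives \<open>Z\<^sub>N = N! h\<^sub>0 \<dots> h\<^sub>N\<^sub>-\<^sub>1\<close>, and differentiating
  the orthogonality relations twice yields a telescoping sum (Toda equations):
  \<open>(ln (h\<^sub>0 \<dots> h\<^sub>N\<^sub>-\<^sub>1))''\<close> is \<open>N\<^sup>2\<close> times the bracket expression of the theorem. After undoing the scaling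
  this is \<open>F\<^sub>N'' = - (bracket - 1/2) / \<tau>\<^sup>2\<close>, and two integrations by parts leave the boundary terms
  \<open>(T - t) F\<^sub>N' T - F\<^sub>N T\<close>. As \<open>T\<close> tends to infinity the moments tend to those of \<open>exp (- N z\<^sup>2)\<close>, for
  which \<open>L p' = 2 N L (x p)\<close> determines all norms; hence \<open>F\<^sub>N T\<close> tends to the Gaussian free energy and
  the other boundary term vanishes.
\<close>

text \<open>Weights enter only through their moment sequences. Each \<open>OP m n\<close> is a
  rational expression in finitely many moments whose denominators \<open>OP_norm\<close> are
  positive, so limits and derivatives of all recurrence data follow from those of single moments.
  The derivative of P_n is never computed from that expression. It has degree below n, and
  differentiating L (P_n P_k) = 0 for k < n determines its expansion. In the orthonormal basis the
  derivative of the n-th diagonal entry of x^2 is then, up to a factor, the sum of the squared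
  entries linking n to smaller indices minus the sum of those linking n to larger ones. Summed over
  n < N, only the links across N survive; x^2 has bandwidth two, so there are three of them, and
  they form the bracket. The value t = 1, that is s = 0, is an endpoint, since the moments are
  estimated for s \<ge> 0 only. Hence they are differentiated one-sidedly there, the Toda equations
  are used for s > 0, and the integration relies on mere continuity at the endpoint.\<close>

hide_const (open) Module.smult

section \<open>Orthogonal polynomials of a moment functional\<close>

definition moment_functional :: "(nat \<Rightarrow> real) \<Rightarrow> real poly \<Rightarrow> real" where
  "moment_functional m p = (\<Sum>i\<le>degree p. coeff p i * m i)"

definition polyX :: "real poly" where "polyX = [:0, 1:]"

lemma poly_polyX [simp]: "poly polyX x = x"
  by (simp add: polyX_def)

lemma degree_polyX [simp]: "degree polyX = 1"
  by (simp add: polyX_def)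

lemma polyX_neq_0 [simp]: "polyX \<noteq> 0"
  by (simp add: polyX_def)

lemma coeff_polyX_mult: "coeff (polyX * p) i = (case i of 0 \<Rightarrow> 0 | Suc j \<Rightarrow> coeff p j)"
  by (simp add: polyX_def coeff_pCons)

lemma moment_functional_eq_sum:
  assumes "degree p \<le> n"
  shows "moment_functional m p = (\<Sum>i\<le>n. coeff p i * m i)"
  unfolding moment_functional_def
  using assms by (intro sum.mono_neutral_left) (auto simp: coeff_eq_0)

lemma moment_functional_0 [simp]: "moment_functional m 0 = 0"
  by (simp add: moment_functional_def)

lemma moment_functional_add:
  "moment_functional m (p + q) = moment_functional m p + moment_functional m q"
proof -
  let ?n = "max (degree p) (degree q)"
  have "moment_functional m (p + q) = (\<Sum>i\<le>?n. coeff (p + q) i * m i)"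
    by (rule moment_functional_eq_sum) (rule degree_add_le_max)
  also have "\<dots> = (\<Sum>i\<le>?n. coeff p i * m i) + (\<Sum>i\<le>?n. coeff q i * m i)"
    by (simp add: sum.distrib algebra_simps)
  finally show ?thesis
    by (simp add: moment_functional_eq_sum[of p ?n] moment_functional_eq_sum[of q ?n])
qed

lemma moment_functional_smult:
  "moment_functional m (smult c p) = c * moment_functional m p"
  by (simp add: moment_functional_eq_sum[of "smult c p" "degree p"] moment_functional_def
      degree_smult_le sum_distrib_left mult.assoc)

lemma moment_functional_minus:
  "moment_functional m (- p) = - moment_functional m p"
  using moment_functional_smult[of m "-1" p] by simp

lemma moment_functional_diff:
  "moment_functional m (p - q) = moment_functional m p - moment_functional m q"
  using moment_functional_add[of m p "- q"] by (simp add: moment_functional_minus)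

lemma moment_functional_sum:
  "moment_functional m (\<Sum>i\<in>A. f i) = (\<Sum>i\<in>A. moment_functional m (f i))"
  by (induction A rule: infinite_finite_induct) (simp_all add: moment_functional_add)

lemmas moment_functional_linear =
  moment_functional_add moment_functional_diff moment_functional_smult moment_functional_minus

text \<open>The second equation keeps the shape of the third (\<open>1 * 1\<close> for \<open>OP m 0 * OP m 0\<close>), so that the same
  closure rules for limits and derivatives apply to both.\<close>

fun OP :: "(nat \<Rightarrow> real) \<Rightarrow> nat \<Rightarrow> real poly" where
  "OP m 0 = 1"
| "OP m (Suc 0) =
    polyX - smult (moment_functional m (polyX * (1 * 1)) / moment_functional m (1 * 1)) 1"
| "OP m (Suc (Suc n)) = polyX * OP m (Suc n)
    - smult (moment_functional m (polyX * (OP m (Suc n) * OP m (Suc n))) /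
             moment_functional m (OP m (Suc n) * OP m (Suc n))) (OP m (Suc n))
    - smult (moment_functional m (OP m (Suc n) * OP m (Suc n)) /
             moment_functional m (OP m n * OP m n)) (OP m n)"

definition OP_norm :: "(nat \<Rightarrow> real) \<Rightarrow> nat \<Rightarrow> real" where
  "OP_norm m n = moment_functional m (OP m n * OP m n)"

definition OP_beta :: "(nat \<Rightarrow> real) \<Rightarrow> nat \<Rightarrow> real" where
  "OP_beta m n = moment_functional m (polyX * (OP m n * OP m n)) / OP_norm m n"

definition OP_gamma2 :: "(nat \<Rightarrow> real) \<Rightarrow> nat \<Rightarrow> real" where
  "OP_gamma2 m n = (if n = 0 then 0 else OP_norm m n / OP_norm m (n - 1))"

lemma OP_gamma2_0 [simp]: "OP_gamma2 m 0 = 0"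
  by (simp add: OP_gamma2_def)

text \<open>For \<open>n = 0\<close> the junk term \<open>OP m (0 - 1) = OP m 0\<close> has coefficient \<open>OP_gamma2 m 0 = 0\<close>.\<close>

lemma OP_recurrence:
  "polyX * OP m n = OP m (Suc n) + smult (OP_beta m n) (OP m n)
     + smult (OP_gamma2 m n) (OP m (n - 1))"
  by (cases n) (simp_all add: OP_beta_def OP_norm_def OP_gamma2_def)

lemma OP_monic: "degree (OP m n) = n \<and> lead_coeff (OP m n) = 1"
proof (induction m n rule: OP.induct)
  case (1 m)
  then show ?case by simp
next
  case (2 m)
  then show ?case by (simp add: polyX_def)
next
  case (3 m n)
  let ?p = "polyX * OP m (Suc n)"
  let ?r = "smult (moment_functional m (polyX * (OP m (Suc n) * OP m (Suc n))) /
             moment_functional m (OP m (Suc n) * OP m (Suc n))) (OP m (Suc n))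
    + smult (moment_functional m (OP m (Suc n) * OP m (Suc n)) /
             moment_functional m (OP m n * OP m n)) (OP m n)"
  have eq: "OP m (Suc (Suc n)) = ?p + (- ?r)" by simp
  have deg: "degree (OP m n) = n" "degree (OP m (Suc n)) = Suc n"
    and lc: "coeff (OP m (Suc n)) (Suc n) = 1"
    using 3 by auto
  then have z: "coeff (OP m n) (Suc (Suc n)) = 0" "coeff (OP m (Suc n)) (Suc (Suc n)) = 0"
    by (auto intro: coeff_eq_0)
  have dp: "degree ?p = Suc (Suc n)"
    using deg by (subst degree_mult_eq) auto
  have "degree ?r \<le> Suc n"
    using deg by (intro degree_add_le order.trans[OF degree_smult_le]) auto
  then have dr: "degree (- ?r) < degree ?p"
    unfolding dp degree_minus by linarith
  have "degree (OP m (Suc (Suc n))) = Suc (Suc n)"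
    unfolding eq using degree_add_eq_left[OF dr] dp by simp
  moreover have "coeff (OP m (Suc (Suc n))) (Suc (Suc n)) = 1"
    unfolding eq using lc z by (simp add: coeff_polyX_mult del: OP.simps)
  ultimately show ?case by simp
qed

lemma degree_OP [simp]: "degree (OP m n) = n"
  using OP_monic by blast

lemma coeff_OP_self [simp]: "coeff (OP m n) n = 1"
  using OP_monic[of m n] by simp

lemma OP_neq_0 [simp]: "OP m n \<noteq> 0"
  using coeff_OP_self[of m n] by (metis coeff_0 zero_neq_one)

declare OP.simps [simp del]

section \<open>Entries of multiplication by x^2 and their flux across an index\<close>

definition OP_sq :: "(nat \<Rightarrow> real) \<Rightarrow> nat \<Rightarrow> nat \<Rightarrow> real" where
  "OP_sq m n k = moment_functional m (polyX * polyX * OP m n * OP m k)"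

text \<open>For positive moments this is the sum of the squared entries of x^2, in the orthonormal
  basis, with row index below \<open>n\<close> and column index at least \<open>n\<close>: the
  entries (n-2, n), (n-1, n) and (n-1, n+1). It is 0 at n = 0 because of
  \<open>OP_gamma2_0\<close>.\<close>

definition toda_flux :: "(nat \<Rightarrow> real) \<Rightarrow> nat \<Rightarrow> real" where
  "toda_flux m n = OP_gamma2 m n * (OP_gamma2 m (n - 1) + OP_gamma2 m (n + 1)
     + (OP_beta m n)\<^sup>2 + 2 * OP_beta m n * OP_beta m (n - 1) + (OP_beta m (n - 1))\<^sup>2)"

locale positive_moments =
  fixes m :: "nat \<Rightarrow> real"
  assumes moment_functional_pos: "p \<noteq> 0 \<Longrightarrow> moment_functional m (p * p) > 0"
begin

abbreviation "L \<equiv> moment_functional m"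
abbreviation "P \<equiv> OP m"
abbreviation "h \<equiv> OP_norm m"
abbreviation "\<beta> \<equiv> OP_beta m"
abbreviation "\<Gamma> \<equiv> OP_gamma2 m"
abbreviation "sq \<equiv> OP_sq m"

lemma OP_norm_pos: "h n > 0"
  unfolding OP_norm_def by (rule moment_functional_pos) simp

lemma OP_norm_neq_0 [simp]: "h n \<noteq> 0"
  using OP_norm_pos[of n] by simp

lemma L_polyX_OP: 
  "L (polyX * P n * q) = L (P (Suc n) * q) + \<beta> n * L (P n * q) + \<Gamma> n * L (P (n - 1) * q)"
  by (simp add: OP_recurrence distrib_right moment_functional_linear)

text \<open>The recurrence is the definition, so orthogonality has to be derived from it.
  Multiplication by x is symmetric for \<open>L\<close> and may be moved from \<open>P n'\<close> to
  \<open>P k\<close>. For k + 1 < \<open>n'\<close> every term then vanishes by induction; for k =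
  \<open>n'\<close> and k + 1 = \<open>n'\<close> the choice of \<open>OP_beta\<close> and
  \<open>OP_gamma2\<close> produces the cancellation.\<close>

lemma OP_orthogonal_less: "k < n \<Longrightarrow> L (P n * P k) = 0"
proof (induction n arbitrary: k rule: less_induct)
  case (less n)
  show ?case
  proof (cases n)
    case 0
    then show ?thesis using less.prems by simp
  next
    case (Suc n')
    have swap: "L (polyX * P n' * P k) = L (polyX * P k * P n')"
      by (simp add: mult_ac)
    have exp: "L (P n * P k) = L (polyX * P n' * P k) - \<beta> n' * L (P n' * P k) - \<Gamma> n' * L (P (n' - 1) * P k)"
      using L_polyX_OP[of n' "P k"] Suc by simp
    have orth: "L (P i * P j) = 0" if "i \<noteq> j" "i < n" "j < n" for i j
      using that less.IH[of i j] less.IH[of j i] by (cases "i < j") (auto simp: mult.commute)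
    have diag: "L (P i * P i) = h i" for i
      by (simp add: OP_norm_def)
    consider "k = n'" | "n' = Suc k" | "Suc k < n'"
      using less.prems Suc by linarith
    then show ?thesis
    proof cases
      case 1
      have "L (polyX * P n' * P n') = \<beta> n' * h n'"
        using OP_norm_neq_0[of n'] by (simp add: OP_beta_def mult.assoc del: OP_norm_neq_0)
      moreover have "\<Gamma> n' * L (P (n' - 1) * P n') = 0"
        using orth[of "n' - 1" n'] Suc by (cases n') auto
      ultimately show ?thesis
        using exp 1 by (simp add: diag)
    next
      case 2
      have "L (P (Suc k) * P n') = h n'" "L (P k * P n') = 0" "\<Gamma> k * L (P (k - 1) * P n') = 0"
        using orth[of k n'] orth[of "k - 1" n'] 2 Suc by (cases k; simp add: diag)+
      then have "L (polyX * P n' * P k) = h n'"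
        unfolding swap unfolding L_polyX_OP by simp
      moreover have "\<Gamma> n' * h k = h n'"
        using 2 by (simp add: OP_gamma2_def)
      moreover have "L (P n' * P k) = 0"
        using orth[of n' k] 2 Suc by simp
      moreover have "L (P (n' - 1) * P k) = h k"
        using 2 by (simp add: diag)
      ultimately show ?thesis
        unfolding exp by simp
    next
      case 3
      have "L (P (Suc k) * P n') = 0" "L (P k * P n') = 0" "L (P (k - 1) * P n') = 0"
        using orth[of "Suc k" n'] orth[of k n'] orth[of "k - 1" n'] 3 Suc by auto
      then have "L (polyX * P n' * P k) = 0"
        unfolding swap unfolding L_polyX_OP by simp
      moreover have "L (P n' * P k) = 0" "L (P (n' - 1) * P k) = 0"
        using orth[of n' k] orth[of "n' - 1" k] 3 Suc by auto
      ultimately show ?thesis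
        unfolding exp by simp
    qed
  qed
qed

lemma OP_orthogonal: "L (P n * P k) = (if n = k then h n else 0)"
  using OP_orthogonal_less[of n k] OP_orthogonal_less[of k n]
  by (cases n k rule: linorder_cases) (auto simp: mult.commute OP_norm_def)

text \<open>Induction on \<open>K\<close> splits off the multiple of the last \<open>P K\<close>
  that removes the top coefficient. Vanishing coefficients, rather than a strict degree bound, make
  \<open>K = 0\<close> available, as needed for the derivative of \<open>OP\<close> at index 0. Only
  one of the two factors has to be of low degree.\<close>

lemma parseval:
  assumes "\<And>i. i \<ge> K \<Longrightarrow> coeff p i = 0"
  shows "L (p * q) = (\<Sum>k<K. L (p * P k) * L (q * P k) / h k)"
  using assms
proof (induction K arbitrary: p q)
  case 0
  then have "p = 0"
    by (intro poly_eqI) simp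
  then show ?case
    by simp
next
  case (Suc K)
  define c where "c = coeff p K"
  define r where "r = p - smult c (P K)"
  have p: "p = r + smult c (P K)"
    by (simp add: r_def)
  have cr: "coeff r i = 0" if "i \<ge> K" for i
    using that Suc.prems unfolding r_def c_def
    by (cases "i = K") (auto simp: coeff_eq_0)
  have r: "L (r * q) = (\<Sum>k<K. L (r * P k) * L (q * P k) / h k)" for q
    by (rule Suc.IH) (rule cr)
  have pk: "L (p * P k) = L (r * P k)" if "k < K" for k
    using that unfolding p by (simp add: distrib_right moment_functional_linear OP_orthogonal)
  have "L (r * P K) = 0"
    by (subst r, intro sum.neutral) (auto simp: OP_orthogonal)
  then have pK: "L (p * P K) = c * h K"
    unfolding p by (simp add: distrib_right moment_functional_linear OP_orthogonal)
  have "L (p * q) = L (r * q) + c * L (q * P K)"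
    unfolding p by (simp add: distrib_right moment_functional_linear mult.commute[of q "P K"])
  also have "L (r * q) = (\<Sum>k<K. L (p * P k) * L (q * P k) / h k)"
    by (subst r) (simp add: pk)
  finally show ?case
    by (simp add: pK)
qed

text \<open>Subtracting the leading multiple of \<open>P n\<close> leaves a polynomial of degree
  below n, which is orthogonal to \<open>P n\<close>. This evaluates the derivative terms for the
  Gaussian weight.\<close>

lemma L_OP_lead:
  assumes "\<And>i. i > n \<Longrightarrow> coeff q i = 0"
  shows "L (q * P n) = coeff q n * h n"
proof -
  define r where "r = q - smult (coeff q n) (P n)"
  have r0: "coeff r i = 0" if "i \<ge> n" for i
    using that assms by (cases "i = n") (auto simp: r_def coeff_eq_0)
  have "L (r * P n) = 0"
    by (subst parseval[OF r0]) (auto intro!: sum.neutral simp: OP_orthogonal)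
  then show ?thesis
    by (simp add: r_def left_diff_distrib moment_functional_linear OP_orthogonal)
qed

lemma L_polyX_OP_OP:
  "L (polyX * P n * P k) =
     (if k = Suc n then h k else if k = n then \<beta> n * h n else if n = Suc k then h n else 0)"
proof -
  have 1: "L (polyX * P n * P k) = (if k = Suc n then h k else if k = n then \<beta> n * h n else 0)"
    if "n \<le> k" for n k
    unfolding L_polyX_OP using that by (cases n) (auto simp: OP_orthogonal)
  have 2: "polyX * P n * P k = polyX * P k * P n"
    by (simp add: mult_ac)
  show ?thesis
    using 1[of n k] 1[of k n] unfolding 2 by (cases "n \<le> k") auto
qed

lemma sq_commute: "sq n k = sq k n"
  by (simp add: OP_sq_def mult_ac)

text \<open>One factor x acts on \<open>P k\<close> by the recurrence, the other stays with
  \<open>P n\<close>, so the tridiagonal entries of \<open>L_polyX_OP_OP\<close> suffice.\<close>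

lemma sq_expand: "sq n k = L (polyX * P n * P (Suc k)) + \<beta> k * L (polyX * P n * P k)
   + \<Gamma> k * L (polyX * P n * P (k - 1))"
proof -
  have "sq n k = L (polyX * P k * (polyX * P n))"
    by (simp add: OP_sq_def mult_ac)
  also have "\<dots> = L (P (Suc k) * (polyX * P n)) + \<beta> k * L (P k * (polyX * P n))
   + \<Gamma> k * L (P (k - 1) * (polyX * P n))"
    by (rule L_polyX_OP)
  finally show ?thesis
    by (simp add: mult_ac)
qed

lemma Gamma_mult_norm: "\<Gamma> (Suc n) * h n = h (Suc n)"
  by (simp add: OP_gamma2_def)

lemma sq_Suc: "sq n (Suc n) = (\<beta> n + \<beta> (Suc n)) * h (Suc n)"
  unfolding sq_expand using Gamma_mult_norm[of n]
  by (simp add: L_polyX_OP_OP) (simp add: algebra_simps)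

lemma sq_Suc_Suc: "sq n (Suc (Suc n)) = h (Suc (Suc n))"
  unfolding sq_expand using Gamma_mult_norm[of "Suc n"]
  by (simp add: L_polyX_OP_OP)

lemma sq_far: "Suc (Suc n) < k \<Longrightarrow> sq n k = 0"
  unfolding sq_expand L_polyX_OP_OP by auto

text \<open>Bandwidth two leaves at most k = n - 1 and k = n - 2. At n = 0 and n = 1 the absent
  terms are matched on the right by \<open>OP_gamma2_0\<close>.\<close>

lemma sum_sq_below:
  "(\<Sum>k<n. (sq n k)\<^sup>2 / h k) = h n * (\<Gamma> n * (\<Gamma> (n - 1) + (\<beta> n + \<beta> (n - 1))\<^sup>2))"
proof -
  consider "n = 0" | "n = 1" | i where "n = Suc (Suc i)"
    by (metis One_nat_def not0_implies_Suc)
  then show ?thesis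
  proof cases
    case 2
    then show ?thesis
      by (simp add: sq_commute[of "Suc 0" 0] sq_Suc power2_eq_square OP_gamma2_def add.commute)
  next
    case 3
    have "(\<Sum>k<i. (sq n k)\<^sup>2 / h k) = 0"
      using 3 sq_far[of _ n] sq_commute[of n] by (intro sum.neutral) auto
    then have "(\<Sum>k<n. (sq n k)\<^sup>2 / h k) = (sq i n)\<^sup>2 / h i + (sq (Suc i) n)\<^sup>2 / h (Suc i)"
      using 3 sq_commute[of n i] sq_commute[of n "Suc i"] by simp
    also have "\<dots> = h n * (h n / h i + (\<beta> (Suc i) + \<beta> n)\<^sup>2 * (h n / h (Suc i)))"
      unfolding 3 sq_Suc sq_Suc_Suc power_mult_distrib
      by (simp add: power2_eq_square[of "h (Suc (Suc i))"] distrib_left)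
    also have "h n / h i = \<Gamma> n * \<Gamma> (Suc i)"
      using 3 by (simp add: OP_gamma2_def)
    also have "h n / h (Suc i) = \<Gamma> n"
      using 3 by (simp add: OP_gamma2_def)
    finally show ?thesis
      using 3 by (simp add: algebra_simps)
  qed simp
qed

lemma sum_sq_above:
  "(sq n (Suc n))\<^sup>2 / h (Suc n) + (sq n (Suc (Suc n)))\<^sup>2 / h (Suc (Suc n))
   = h n * (\<Gamma> (Suc n) * (\<Gamma> (Suc (Suc n)) + (\<beta> (Suc n) + \<beta> n)\<^sup>2))"
proof -
  have "(sq n (Suc n))\<^sup>2 / h (Suc n) + (sq n (Suc (Suc n)))\<^sup>2 / h (Suc (Suc n))
    = (\<beta> n + \<beta> (Suc n))\<^sup>2 * h (Suc n) + h (Suc (Suc n))"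
    unfolding sq_Suc sq_Suc_Suc by (simp add: power2_eq_square)
  moreover have "h (Suc (Suc n)) = h n * \<Gamma> (Suc n) * \<Gamma> (Suc (Suc n))"
    using Gamma_mult_norm[of "Suc n"] Gamma_mult_norm[of n] by (simp add: mult_ac)
  moreover have "h (Suc n) = h n * \<Gamma> (Suc n)"
    using Gamma_mult_norm[of n] by (simp add: mult_ac)
  ultimately have "(sq n (Suc n))\<^sup>2 / h (Suc n) + (sq n (Suc (Suc n)))\<^sup>2 / h (Suc (Suc n))
    = (\<beta> n + \<beta> (Suc n))\<^sup>2 * (h n * \<Gamma> (Suc n)) + h n * \<Gamma> (Suc n) * \<Gamma> (Suc (Suc n))"
    by (simp only:)
  then show ?thesis
    by (simp only: distrib_left mult_ac add_ac)
qed

text \<open>Parseval for x^2 \<open>P n\<close>, of degree n + 2, paired with itself. This quantity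
  appears when \<open>OP_sq\<close> is differentiated.\<close>

lemma L_polyX4:
  "L ((polyX * polyX * P n) * (polyX * polyX * P n)) = (\<Sum>k<n. (sq n k)\<^sup>2 / h k)
     + (sq n n)\<^sup>2 / h n + h n * (\<Gamma> (Suc n) * (\<Gamma> (Suc (Suc n)) + (\<beta> (Suc n) + \<beta> n)\<^sup>2))"
proof -
  have "degree (polyX * polyX * P n) = n + 2"
    by (simp add: degree_mult_eq)
  then have "L ((polyX * polyX * P n) * (polyX * polyX * P n)) = (\<Sum>k<n + 3. (sq n k)\<^sup>2 / h k)"
    by (subst parseval[of "n + 3"]) (auto intro: coeff_eq_0 simp add: OP_sq_def power2_eq_square)
  also have "\<dots> = (\<Sum>k<n. (sq n k)\<^sup>2 / h k) + (sq n n)\<^sup>2 / h n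
      + ((sq n (Suc n))\<^sup>2 / h (Suc n) + (sq n (Suc (Suc n)))\<^sup>2 / h (Suc (Suc n)))"
    by (simp add: numeral_3_eq_3)
  finally show ?thesis
    by (simp add: sum_sq_above)
qed

text \<open>The subtracted bracket is the sum over k > n. The product \<Gamma> n * \<Gamma> (Suc n)
  occurs in both fluxes and cancels: it belongs to the entry linking n - 1 and n + 1, which does not
  touch row n.\<close>

lemma toda_flux_diff:
  "(\<Sum>k<n. (sq n k)\<^sup>2 / h k) - (L ((polyX * polyX * P n) * (polyX * polyX * P n))
      - (\<Sum>k<n. (sq n k)\<^sup>2 / h k) - (sq n n)\<^sup>2 / h n)
   = h n * (toda_flux m n - toda_flux m (Suc n))"
  unfolding L_polyX4 sum_sq_below
  by (simp add: toda_flux_def power2_eq_square algebra_simps)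

end

section \<open>Dependence on the moments\<close>

definition poly_tendsto :: "('a \<Rightarrow> real poly) \<Rightarrow> real poly \<Rightarrow> 'a filter \<Rightarrow> bool" where
  "poly_tendsto p p0 F \<longleftrightarrow> (\<forall>i. ((\<lambda>x. coeff (p x) i) \<longlongrightarrow> coeff p0 i) F) \<and>
     (\<exists>n. degree p0 \<le> n \<and> (\<forall>x. degree (p x) \<le> n))"

lemma poly_tendsto_const [intro]: "poly_tendsto (\<lambda>_. p) p F"
  by (auto simp: poly_tendsto_def)

lemma poly_tendsto_diff [intro]:
  assumes "poly_tendsto p p0 F" "poly_tendsto q q0 F"
  shows "poly_tendsto (\<lambda>x. p x - q x) (p0 - q0) F"
proof -
  from assms obtain a b where "degree p0 \<le> a" "\<forall>x. degree (p x) \<le> a"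
     "degree q0 \<le> b" "\<forall>x. degree (q x) \<le> b"
    by (auto simp: poly_tendsto_def)
  then have "degree (p0 - q0) \<le> max a b \<and> (\<forall>x. degree (p x - q x) \<le> max a b)"
    by (auto intro!: order.trans[OF degree_diff_le_max] max.mono)
  then show ?thesis
    using assms by (auto simp: poly_tendsto_def intro!: tendsto_diff)
qed

lemma poly_tendsto_mult [intro]:
  assumes "poly_tendsto p p0 F" "poly_tendsto q q0 F"
  shows "poly_tendsto (\<lambda>x. p x * q x) (p0 * q0) F"
proof -
  from assms obtain a b where "degree p0 \<le> a" "\<forall>x. degree (p x) \<le> a"
     "degree q0 \<le> b" "\<forall>x. degree (q x) \<le> b"
    by (auto simp: poly_tendsto_def)
  then have "degree (p0 * q0) \<le> a + b \<and> (\<forall>x. degree (p x * q x) \<le> a + b)"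
    by (auto intro: order.trans[OF degree_mult_le] add_mono)
  then show ?thesis
    using assms by (auto simp: poly_tendsto_def coeff_mult intro!: tendsto_sum tendsto_mult)
qed

lemma poly_tendsto_smult [intro]:
  assumes "(c \<longlongrightarrow> c0) F" "poly_tendsto q q0 F"
  shows "poly_tendsto (\<lambda>x. smult (c x) (q x)) (smult c0 q0) F"
proof -
  have "poly_tendsto (\<lambda>x. [:c x:]) [:c0:] F"
    using assms(1) by (auto simp: poly_tendsto_def coeff_pCons split: nat.splits)
  from poly_tendsto_mult[OF this assms(2)] show ?thesis
    by simp
qed

text \<open>The degree bound in \<open>poly_tendsto\<close> is uniform so that all functionals
  become sums over one fixed index range; \<open>degree (p x)\<close> itself may jump.\<close>

lemma tendsto_moment_functional:
  assumes "\<And>k. ((\<lambda>x. m x k) \<longlongrightarrow> m0 k) F" and p: "poly_tendsto p p0 F"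
  shows "((\<lambda>x. moment_functional (m x) (p x)) \<longlongrightarrow> moment_functional m0 p0) F"
proof -
  from p obtain n where "degree p0 \<le> n" "\<forall>x. degree (p x) \<le> n"
    by (auto simp: poly_tendsto_def)
  then show ?thesis
    using assms
    by (auto simp: moment_functional_eq_sum[where n = n] poly_tendsto_def intro!: tendsto_sum tendsto_mult)
qed

text \<open>Closure under the operations of the recurrence. Positivity is asked of the limit
  functional alone: it keeps the limits of the denominators nonzero.\<close>

lemma poly_tendsto_OP:
  assumes m: "\<And>k. ((\<lambda>x. m x k) \<longlongrightarrow> m0 k) F" and pos: "positive_moments m0"
  shows "poly_tendsto (\<lambda>x. OP (m x) n) (OP m0 n) F"
proof (induction n rule: less_induct)
  case (less n)
  interpret positive_moments m0 by fact
  have nz: "moment_functional m0 (OP m0 k * OP m0 k) \<noteq> 0" for k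
    using OP_norm_neq_0[of k] by (simp add: OP_norm_def del: OP_norm_neq_0)
  consider "n = 0" | "n = 1" | i where "n = Suc (Suc i)"
    by (metis One_nat_def not0_implies_Suc)
  then show ?case
  proof cases
    case 1
    then show ?thesis by (auto simp: OP.simps)
  next
    case 2
    show ?thesis
      unfolding 2 One_nat_def OP.simps
      by (intro poly_tendsto_diff poly_tendsto_smult tendsto_divide
         tendsto_moment_functional m poly_tendsto_const nz[of 0, unfolded OP.simps])
  next
    case 3
    then show ?thesis
      using less.IH[of i] less.IH[of "Suc i"] nz
      by (auto simp: OP.simps(3) intro!: poly_tendsto_diff poly_tendsto_mult
         poly_tendsto_smult tendsto_divide tendsto_moment_functional m poly_tendsto_const)
  qed
qed

lemma
  assumes m: "\<And>k. ((\<lambda>x. m x k) \<longlongrightarrow> m0 k) F" and pos: "positive_moments m0"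
  shows tendsto_OP_norm: "((\<lambda>x. OP_norm (m x) n) \<longlongrightarrow> OP_norm m0 n) F"
    and tendsto_OP_sq: "((\<lambda>x. OP_sq (m x) n k) \<longlongrightarrow> OP_sq m0 n k) F"
    and tendsto_toda_flux: "((\<lambda>x. toda_flux (m x) n) \<longlongrightarrow> toda_flux m0 n) F"
proof -
  interpret positive_moments m0 by fact
  note P = poly_tendsto_OP[OF m pos]
  show h: "((\<lambda>x. OP_norm (m x) n) \<longlongrightarrow> OP_norm m0 n) F" for n
    unfolding OP_norm_def by (intro tendsto_moment_functional m P poly_tendsto_mult)
  show "((\<lambda>x. OP_sq (m x) n k) \<longlongrightarrow> OP_sq m0 n k) F"
    unfolding OP_sq_def by (intro tendsto_moment_functional m P poly_tendsto_mult poly_tendsto_const)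
  have \<beta>: "((\<lambda>x. OP_beta (m x) n) \<longlongrightarrow> OP_beta m0 n) F" for n
    unfolding OP_beta_def
    by (intro tendsto_divide tendsto_moment_functional m h P poly_tendsto_mult poly_tendsto_const) simp
  have \<Gamma>: "((\<lambda>x. OP_gamma2 (m x) n) \<longlongrightarrow> OP_gamma2 m0 n) F" for n
    unfolding OP_gamma2_def by (cases n) (auto intro!: tendsto_divide h)
  show "((\<lambda>x. toda_flux (m x) n) \<longlongrightarrow> toda_flux m0 n) F"
    unfolding toda_flux_def by (intro tendsto_intros \<beta> \<Gamma>)
qed

section \<open>Derivatives of the recurrence data\<close>

definition poly_deriv :: "(real \<Rightarrow> real poly) \<Rightarrow> real poly \<Rightarrow> real \<Rightarrow> bool" where
  "poly_deriv p p' s \<longleftrightarrow> (\<forall>i. ((\<lambda>x. coeff (p x) i) has_real_derivative coeff p' i) (at s)) \<and>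
     (\<exists>n. degree p' \<le> n \<and> (\<forall>x. degree (p x) \<le> n))"

lemma poly_deriv_const: "poly_deriv (\<lambda>_. p) 0 s"
  by (auto simp: poly_deriv_def)

lemma poly_deriv_diff:
  assumes "poly_deriv p p' s" "poly_deriv q q' s"
  shows "poly_deriv (\<lambda>x. p x - q x) (p' - q') s"
proof -
  from assms obtain a b where "degree p' \<le> a" "\<forall>x. degree (p x) \<le> a"
     "degree q' \<le> b" "\<forall>x. degree (q x) \<le> b"
    by (auto simp: poly_deriv_def)
  then have "degree (p' - q') \<le> max a b \<and> (\<forall>x. degree (p x - q x) \<le> max a b)"
    by (auto intro!: order.trans[OF degree_diff_le_max] max.mono)
  then show ?thesis
    using assms by (auto simp: poly_deriv_def intro!: DERIV_diff)
qed

lemma poly_deriv_mult: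
  assumes "poly_deriv p p' s" "poly_deriv q q' s"
  shows "poly_deriv (\<lambda>x. p x * q x) (p' * q s + p s * q') s"
proof -
  from assms obtain a b where "degree p' \<le> a" "\<forall>x. degree (p x) \<le> a"
     "degree q' \<le> b" "\<forall>x. degree (q x) \<le> b"
    by (auto simp: poly_deriv_def)
  then have "degree (p' * q s + p s * q') \<le> a + b \<and> (\<forall>x. degree (p x * q x) \<le> a + b)"
    by (auto intro!: degree_add_le intro: order.trans[OF degree_mult_le] add_mono)
  moreover have "((\<lambda>x. coeff (p x * q x) i) has_real_derivative
      coeff (p' * q s + p s * q') i) (at s)" for i
  proof -
    have "((\<lambda>x. \<Sum>j\<le>i. coeff (p x) j * coeff (q x) (i - j)) has_real_derivative
       (\<Sum>j\<le>i. coeff p' j * coeff (q s) (i - j) + coeff q' (i - j) * coeff (p s) j)) (at s)"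
      using assms by (intro DERIV_sum DERIV_mult) (auto simp: poly_deriv_def)
    then show ?thesis
      by (simp only: coeff_mult coeff_add sum.distrib mult.commute[of "coeff q' _"])
  qed
  ultimately show ?thesis
    by (auto simp: poly_deriv_def)
qed

lemma poly_deriv_smult:
  assumes "(c has_real_derivative c') (at s)" "poly_deriv q q' s"
  shows "poly_deriv (\<lambda>x. smult (c x) (q x)) (smult c' (q s) + smult (c s) q') s"
proof -
  have "poly_deriv (\<lambda>x. [:c x:]) [:c':] s"
    using assms(1) by (auto simp: poly_deriv_def coeff_pCons split: nat.splits)
  from poly_deriv_mult[OF this assms(2)] show ?thesis
    by simp
qed

text \<open>Product rule: the coefficients contribute \<open>p'\<close>, and shifting every moment
  index by two is multiplication by x^2.\<close>

lemma DERIV_moment_functional: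
  assumes m: "\<And>k. ((\<lambda>x. m x k) has_real_derivative - c * m s (k + 2)) (at s)"
    and p: "poly_deriv p p' s"
  shows "((\<lambda>x. moment_functional (m x) (p x)) has_real_derivative
    moment_functional (m s) p' - c * moment_functional (m s) (polyX * polyX * p s)) (at s)"
proof -
  from p obtain n where n: "degree p' \<le> n" "\<And>x. degree (p x) \<le> n"
    by (auto simp: poly_deriv_def)
  have "degree (polyX * polyX * p s) \<le> Suc (Suc n)"
    by (rule order.trans[OF degree_mult_le]) (use n(2)[of s] in \<open>auto simp: degree_mult_eq\<close>)
  then have "moment_functional (m s) (polyX * polyX * p s)
      = (\<Sum>i\<le>Suc (Suc n). coeff (polyX * polyX * p s) i * m s i)"
    by (rule moment_functional_eq_sum)
  also have "\<dots> = (\<Sum>i\<le>n. coeff (p s) i * m s (i + 2))"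
    by (simp add: sum.atMost_Suc_shift mult.assoc coeff_polyX_mult del: sum.atMost_Suc)
  finally have X: "moment_functional (m s) (polyX * polyX * p s) = \<dots>" .
  have "((\<lambda>x. \<Sum>i\<le>n. coeff (p x) i * m x i) has_real_derivative
     (\<Sum>i\<le>n. coeff p' i * m s i + (- c * m s (i + 2)) * coeff (p s) i)) (at s)"
    using p by (intro DERIV_sum DERIV_mult m) (auto simp: poly_deriv_def)
  also have "(\<Sum>i\<le>n. coeff p' i * m s i + (- c * m s (i + 2)) * coeff (p s) i)
    = moment_functional (m s) p' - c * moment_functional (m s) (polyX * polyX * p s)"
    unfolding X using n(1)
    by (simp add: moment_functional_eq_sum[of p' n] sum.distrib sum_distrib_left sum_negf mult_ac sum_subtractf)
  finally show ?thesis
    using n(2) by (simp add: moment_functional_eq_sum[where n = n])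
qed

text \<open>Existence only; the derivative is identified later from the orthogonality relations. It
  loses the leading term because \<open>OP\<close> is monic for every moment sequence.\<close>

lemma poly_deriv_OP:
  assumes m: "\<And>k. ((\<lambda>x. m x k) has_real_derivative - c * m s (k + 2)) (at s)"
    and pos: "positive_moments (m s)"
  shows "\<exists>q. poly_deriv (\<lambda>x. OP (m x) n) q s \<and> (\<forall>i\<ge>n. coeff q i = 0)"
proof -
  interpret positive_moments "m s" by fact
  have nz: "moment_functional (m s) (OP (m s) k * OP (m s) k) \<noteq> 0" for k
    using OP_norm_neq_0[of k] by (simp add: OP_norm_def del: OP_norm_neq_0)
  \<comment> \<open>The derivative is hidden under an existential quantifier, since its explicit
    form would grow with each step of the recurrence.\<close>
  define D where "D = (\<lambda>p. \<exists>q. poly_deriv p q s)"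
  have const: "D (\<lambda>_. p)" for p
    unfolding D_def using poly_deriv_const by blast
  have diff: "D (\<lambda>x. p x - q x)" if "D p" "D q" for p q
    using that unfolding D_def by (blast intro: poly_deriv_diff)
  have mult: "D (\<lambda>x. p x * q x)" if "D p" "D q" for p q
    using that unfolding D_def by (blast intro: poly_deriv_mult)
  have quot: "D (\<lambda>x. smult (moment_functional (m x) (p x) / moment_functional (m x) (r x)) (q x))"
    if "D p" "D r" "D q" "moment_functional (m s) (r s) \<noteq> 0" for p q r
  proof -
    obtain p' q' r' where d: "poly_deriv p p' s" "poly_deriv q q' s" "poly_deriv r r' s"
      using \<open>D p\<close> \<open>D r\<close> \<open>D q\<close> unfolding D_def by blast
    note DL = DERIV_moment_functional[of m c s, OF m]
    show ?thesis
      unfolding D_def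
      by (rule exI, rule poly_deriv_smult[OF DERIV_divide[OF DL[OF d(1)] DL[OF d(3)]] d(2)]) fact
  qed
  have "D (\<lambda>x. OP (m x) n)"
  proof (induction n rule: less_induct)
    case (less n)
    consider "n = 0" | "n = 1" | i where "n = Suc (Suc i)"
      by (metis One_nat_def not0_implies_Suc)
    then show ?case
    proof cases
      case 1
      then show ?thesis by (simp add: OP.simps const)
    next
      case 2
      show ?thesis
        unfolding 2 One_nat_def OP.simps
        by (intro diff quot const nz[of 0, unfolded OP.simps])
    next
      case 3
      have "D (\<lambda>x. OP (m x) i)" "D (\<lambda>x. OP (m x) (Suc i))"
        using less.IH 3 by auto
      then show ?thesis
        unfolding 3 OP.simps by (intro diff mult quot const nz)
    qed
  qed
  then obtain q where q: "poly_deriv (\<lambda>x. OP (m x) n) q s"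
    unfolding D_def by blast
  have "coeff q i = 0" if "i \<ge> n" for i
  proof -
    have "(\<lambda>x. coeff (OP (m x) n) i) = (\<lambda>x. if i = n then 1 else 0)"
      using that by (auto simp: coeff_eq_0)
    moreover have "((\<lambda>x. coeff (OP (m x) n) i) has_real_derivative coeff q i) (at s)"
      using q by (simp add: poly_deriv_def)
    ultimately show ?thesis
      using DERIV_unique DERIV_const by metis
  qed
  with q show ?thesis by blast
qed

text \<open>The Toda equations: \<open>m\<^sub>k' = - c m\<^sub>k\<^sub>+\<^sub>2\<close> is the effect of a factor \<open>exp (- c s x\<^sup>2)\<close> in the weight.\<close>

lemma
  assumes m: "\<And>k. ((\<lambda>x. m x k) has_real_derivative - c * m s (k + 2)) (at s)"
    and pos: "eventually (\<lambda>x. positive_moments (m x)) (nhds s)"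
  shows DERIV_OP_norm: "((\<lambda>x. OP_norm (m x) n) has_real_derivative - c * OP_sq (m s) n n) (at s)"
    and DERIV_OP_sq: "((\<lambda>x. OP_sq (m x) n n / OP_norm (m x) n) has_real_derivative
           c * (toda_flux (m s) n - toda_flux (m s) (Suc n))) (at s)"
proof -
  have pos_s: "positive_moments (m s)"
    using pos by (rule eventually_nhds_x_imp_x)
  interpret positive_moments "m s" by (fact pos_s)
  obtain q where q: "\<And>n. poly_deriv (\<lambda>x. OP (m x) n) (q n) s"
    and q0: "\<And>n i. i \<ge> n \<Longrightarrow> coeff (q n) i = 0"
    using poly_deriv_OP[OF m pos_s] by metis
  have D: "((\<lambda>x. moment_functional (m x) (OP (m x) n * OP (m x) k)) has_real_derivative
     L (q n * P k + P n * q k) - c * L (polyX * polyX * (P n * P k))) (at s)" for n k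
    by (intro DERIV_moment_functional m poly_deriv_mult q)
  \<comment> \<open>The coefficients of \<open>q k\<close> vanish from k on, so it is a combination
    of \<open>P j\<close> with j < k \<le> n.\<close>
  have qP: "L (q k * P n) = 0" if "k \<le> n" for k n
    using that by (subst parseval[OF q0]) (auto intro!: sum.neutral simp: OP_orthogonal)
  have "L (q n * P n + P n * q n) = 0"
    unfolding moment_functional_add mult.commute[of "P n"] using qP[of n n] by simp
  with D[of n n] show Dh: "((\<lambda>x. OP_norm (m x) n) has_real_derivative - c * sq n n) (at s)"
    by (simp add: OP_norm_def OP_sq_def mult.assoc)
  \<comment> \<open>Orthogonality holds on a whole neighbourhood of \<open>s\<close>, so the
    derivative of L (P_n P_k) is 0; this yields the component of \<open>q n\<close> along
    \<open>P k\<close>.\<close>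
  have qk: "L (q n * P k) = c * sq n k" if "k < n" for k
  proof -
    have "eventually (\<lambda>x. moment_functional (m x) (OP (m x) n * OP (m x) k) = 0) (nhds s)"
      using pos by eventually_elim (use that in \<open>auto simp: positive_moments.OP_orthogonal\<close>)
    then have "((\<lambda>x. moment_functional (m x) (OP (m x) n * OP (m x) k)) has_real_derivative 0) (at s)"
      by (subst DERIV_cong_ev[OF refl _ refl]) auto
    then have "L (q n * P k + P n * q k) - c * L (polyX * polyX * (P n * P k)) = 0"
      using D DERIV_unique by blast
    moreover have "L (P n * q k) = 0"
      using qP[of k n] that by (simp add: mult.commute)
    ultimately show ?thesis
      by (simp add: moment_functional_add OP_sq_def mult.assoc)
  qed
  let ?B = "\<Sum>k<n. (sq n k)\<^sup>2 / h k"
  let ?F = "L ((polyX * polyX * P n) * (polyX * polyX * P n))"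
  have "L (q n * (polyX * polyX * P n)) = (\<Sum>k<n. L (q n * P k) * L ((polyX * polyX * P n) * P k) / h k)"
    by (rule parseval[OF q0])
  also have "\<dots> = c * ?B"
    unfolding sum_distrib_left by (intro sum.cong refl) (simp add: qk OP_sq_def power2_eq_square mult.assoc)
  finally have B: "L (q n * (polyX * polyX * P n)) = c * ?B" .
  have "((\<lambda>x. moment_functional (m x) (polyX * polyX * OP (m x) n * OP (m x) n)) has_real_derivative
     L ((0 * P n + polyX * polyX * q n) * P n + (polyX * polyX * P n) * q n)
       - c * L (polyX * polyX * (polyX * polyX * P n * P n))) (at s)"
    by (intro DERIV_moment_functional m poly_deriv_mult poly_deriv_const q)
  moreover have "L ((0 * P n + polyX * polyX * q n) * P n + (polyX * polyX * P n) * q n)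
      = 2 * L (q n * (polyX * polyX * P n))"
  proof -
    have "(0 * P n + polyX * polyX * q n) * P n + (polyX * polyX * P n) * q n
      = q n * (polyX * polyX * P n) + q n * (polyX * polyX * P n)"
      by (simp only: mult_zero_left add_0_left mult_ac)
    then show ?thesis
      by (simp only: moment_functional_add)
  qed
  moreover have "polyX * polyX * (polyX * polyX * P n * P n) = (polyX * polyX * P n) * (polyX * polyX * P n)"
    by (simp add: mult_ac)
  ultimately have Da: "((\<lambda>x. OP_sq (m x) n n) has_real_derivative 2 * (c * ?B) - c * ?F) (at s)"
    by (simp add: OP_sq_def B)
  \<comment> \<open>The part of \<open>?F\<close> from k > n is traded for the flux difference. The
    remaining squared diagonal entry cancels against the second term of the quotient rule.\<close>
  have F: "?F = 2 * ?B + (sq n n)\<^sup>2 / h n - h n * (toda_flux (m s) n - toda_flux (m s) (Suc n))"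
    using toda_flux_diff[of n] by simp
  have "((\<lambda>x. OP_sq (m x) n n / OP_norm (m x) n) has_real_derivative
     ((2 * (c * ?B) - c * ?F) * h n - sq n n * (- c * sq n n)) / (h n * h n)) (at s)"
    by (rule DERIV_divide[OF Da Dh]) simp
  also have "((2 * (c * ?B) - c * ?F) * h n - sq n n * (- c * sq n n)) / (h n * h n) =
      c * (toda_flux (m s) n - toda_flux (m s) (Suc n))"
    unfolding F by (simp add: field_simps power2_eq_square)
  finally show "((\<lambda>x. OP_sq (m x) n n / OP_norm (m x) n) has_real_derivative
           c * (toda_flux (m s) n - toda_flux (m s) (Suc n))) (at s)" .
qed

section \<open>Scaling of the moments\<close>

context
  fixes c :: real and m m' :: "nat \<Rightarrow> real"
  assumes c: "c \<noteq> 0" and m': "\<And>k. m' k = c ^ (k + 1) * m k"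
begin

definition dilate :: "real poly \<Rightarrow> real poly" where
  "dilate p = pcompose p [:0, 1 / c:]"

text \<open>Under z = c u the exponent k + 1 in \<open>m'\<close> collects k from z^k and 1 from dz.
  Dilation undoes the k powers and leaves the factor of dz.\<close>

lemma moment_functional_dilate: "moment_functional m' (dilate p) = c * moment_functional m p"
proof -
  have "degree (dilate p) = degree p"
    using c by (simp add: dilate_def degree_pcompose)
  then show ?thesis
    using c unfolding moment_functional_def dilate_def
    by (simp add: coeff_pcompose_linear m' sum_distrib_left power_divide mult.left_commute)
qed

lemma dilate_mult: "dilate (p * q) = dilate p * dilate q"
  by (simp add: dilate_def pcompose_mult)

lemma dilate_polyX: "polyX = smult c (dilate polyX)"
  using c by (simp add: dilate_def polyX_def pcompose_pCons)

text \<open>The factor c^n restores the leading coefficient 1. Induction through the recurrence,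
  whose two coefficients scale by c and c^2.\<close>

lemma OP_dilate: "OP m' n = smult (c ^ n) (dilate (OP m n))"
proof (induction n rule: less_induct)
  case (less n)
  have norm: "OP_norm m' k = c ^ (2 * k + 1) * OP_norm m k"
    and beta: "OP_beta m' k = c * OP_beta m k" if "k < n" for k
  proof -
    have "OP_norm m' k = c ^ k * (c ^ k * moment_functional m' (dilate (OP m k * OP m k)))"
      unfolding OP_norm_def less.IH[OF that] by (simp add: dilate_mult moment_functional_smult)
    then show norm: "OP_norm m' k = c ^ (2 * k + 1) * OP_norm m k"
      by (simp add: moment_functional_dilate OP_norm_def power_add mult_2)
    have "moment_functional m' (polyX * (OP m' k * OP m' k)) =
       c ^ k * (c ^ k * (c * moment_functional m' (dilate (polyX * (OP m k * OP m k)))))"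
      unfolding less.IH[OF that] by (subst dilate_polyX) (simp add: dilate_mult moment_functional_smult)
    also have "\<dots> = c * (c ^ (2 * k + 1)) * moment_functional m (polyX * (OP m k * OP m k))"
      by (simp add: moment_functional_dilate power_add mult_2)
    finally show "OP_beta m' k = c * OP_beta m k"
      using c by (simp add: OP_beta_def norm)
  qed
  show ?case
  proof (cases n)
    case 0
    then show ?thesis by (simp add: OP.simps dilate_def pcompose_1)
  next
    case (Suc k)
    have rec: "OP m (Suc k) = polyX * OP m k - smult (OP_beta m k) (OP m k) - smult (OP_gamma2 m k) (OP m (k - 1))" for m
      using OP_recurrence[of m k] by simp
    have gamma: "smult (OP_gamma2 m' k) (OP m' (k - 1)) = smult (c ^ n) (smult (OP_gamma2 m k) (dilate (OP m (k - 1))))"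
    proof (cases k)
      case (Suc j)
      have "OP_gamma2 m' k = c\<^sup>2 * OP_gamma2 m k"
        using Suc \<open>n = Suc k\<close> c by (simp add: OP_gamma2_def norm power2_eq_square)
      then show ?thesis
        using Suc \<open>n = Suc k\<close> by (simp add: less.IH power2_eq_square mult_ac)
    qed simp
    have "OP m' n = smult (c ^ n) (dilate polyX * dilate (OP m k) - smult (OP_beta m k) (dilate (OP m k))
         - smult (OP_gamma2 m k) (dilate (OP m (k - 1))))"
      unfolding Suc rec[of m'] gamma[unfolded Suc]
      by (subst dilate_polyX) (use Suc in \<open>simp add: less.IH beta smult_diff_right mult_ac\<close>)
    also have "\<dots> = smult (c ^ n) (dilate (OP m n))"
      unfolding Suc rec[of m] by (simp add: dilate_def pcompose_diff pcompose_mult pcompose_smult)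
    finally show ?thesis .
  qed
qed

lemma OP_norm_dilate: "OP_norm m' n = c ^ (2 * n + 1) * OP_norm m n"
proof -
  have "OP_norm m' n = c ^ n * (c ^ n * moment_functional m' (dilate (OP m n * OP m n)))"
    unfolding OP_norm_def OP_dilate by (simp add: dilate_mult moment_functional_smult)
  then show ?thesis
    by (simp add: moment_functional_dilate OP_norm_def power_add mult_2)
qed

lemma OP_beta_dilate: "OP_beta m' n = c * OP_beta m n"
proof -
  have "moment_functional m' (polyX * (OP m' n * OP m' n)) =
     c ^ n * (c ^ n * (c * moment_functional m' (dilate (polyX * (OP m n * OP m n)))))"
    unfolding OP_dilate by (subst dilate_polyX) (simp add: dilate_mult moment_functional_smult)
  also have "\<dots> = c * (c ^ (2 * n + 1)) * moment_functional m (polyX * (OP m n * OP m n))"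
    by (simp add: moment_functional_dilate power_add mult_2)
  finally show ?thesis
    using c by (simp add: OP_beta_def OP_norm_dilate)
qed

lemma OP_gamma2_dilate: "OP_gamma2 m' n = c\<^sup>2 * OP_gamma2 m n"
  using c by (cases n) (simp_all add: OP_gamma2_def OP_norm_dilate power2_eq_square)

lemma OP_sq_dilate: "OP_sq m' n n / OP_norm m' n = c\<^sup>2 * (OP_sq m n n / OP_norm m n)"
proof -
  have "OP_sq m' n n =
     c ^ n * (c ^ n * (c * (c * moment_functional m' (dilate (polyX * polyX * OP m n * OP m n)))))"
    unfolding OP_sq_def OP_dilate
    by (subst (1 2) dilate_polyX) (simp add: dilate_mult moment_functional_smult)
  also have "\<dots> = c\<^sup>2 * (c ^ (2 * n + 1)) * OP_sq m n n"
    by (simp add: moment_functional_dilate power_add mult_2 power2_eq_square OP_sq_def)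
  finally show ?thesis
    using c by (simp add: OP_norm_dilate)
qed

lemma toda_flux_dilate: "toda_flux m' n = c ^ 4 * toda_flux m n"
  unfolding toda_flux_def OP_gamma2_dilate OP_beta_dilate
  by (simp add: power2_eq_square power4_eq_xxxx algebra_simps)

end

section \<open>Orthogonal polynomials of a weight\<close>

definition moments :: "(real \<Rightarrow> real) \<Rightarrow> nat \<Rightarrow> real" where
  "moments w k = (LINT x|lborel. x ^ k * w x)"

locale moment_weight =
  fixes w :: "real \<Rightarrow> real"
  assumes pos: "w x > 0" and int: "integrable lborel (\<lambda>x. x ^ k * w x)"
begin

lemma integrable_poly: "integrable lborel (\<lambda>x. poly p x * w x)"
  and LINT_poly: "(LINT x|lborel. poly p x * w x) = moment_functional (moments w) p"
proof -
  have eq: "(\<lambda>x. poly p x * w x) = (\<lambda>x. \<Sum>i\<le>degree p. coeff p i * (x ^ i * w x))"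
    by (simp add: poly_altdef sum_distrib_right mult.assoc)
  show "integrable lborel (\<lambda>x. poly p x * w x)"
    unfolding eq using int by (intro Bochner_Integration.integrable_sum integrable_mult_right) auto
  show "(LINT x|lborel. poly p x * w x) = moment_functional (moments w) p"
    unfolding eq moment_functional_def moments_def using int
    by (subst Bochner_Integration.integral_sum) auto
qed

lemma LINT_poly_mult:
  "(LINT x|lborel. poly p x * poly q x * w x) = moment_functional (moments w) (p * q)"
  using LINT_poly[of "p * q"] by simp

text \<open>L (p * p) is the integral of a nonnegative function that vanishes only at the finitely
  many roots of \<open>p\<close>.\<close>

sublocale positive_moments "moments w"
proof
  fix p :: "real poly" assume "p \<noteq> 0"
  have nn: "0 \<le> poly (p * p) x * w x" for x
    using pos[of x] by simp
  have "(LINT x|lborel. poly (p * p) x * w x) \<noteq> 0"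
  proof
    assume "(LINT x|lborel. poly (p * p) x * w x) = 0"
    then have "AE x in lborel. poly (p * p) x * w x = 0"
      using integral_nonneg_eq_0_iff_AE[OF integrable_poly[of "p * p"]] nn by auto
    moreover have "AE x in lborel. x \<notin> {x. poly p x = 0}"
      using poly_roots_finite[OF \<open>p \<noteq> 0\<close>] by (intro AE_not_in finite_imp_null_set_lborel)
    ultimately have "AE x::real in lborel. False"
    proof (rule eventually_elim2)
      fix x assume "poly (p * p) x * w x = 0" "x \<notin> {x. poly p x = 0}"
      then show False using pos[of x] by simp
    qed
    then show False
      by (simp add: eventually_False ae_filter_eq_bot_iff)
  qed
  moreover have "(LINT x|lborel. poly (p * p) x * w x) \<ge> 0"
    using nn by (intro Bochner_Integration.integral_nonneg)
  ultimately show "moment_functional (moments w) (p * p) > 0"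
    unfolding LINT_poly by simp
qed

text \<open>Uniqueness: the difference of two candidates has degree below n and is orthogonal to
  everything of degree below n, hence to itself.\<close>

lemma monic_OP_eq: "monic_OP w n = P n"
  unfolding monic_OP_def
proof (rule the_equality)
  have "(LINT x|lborel. poly (P n) x * x ^ k * w x) = 0" if "k < n" for k
  proof -
    have "(LINT x|lborel. poly (P n) x * x ^ k * w x) = L (monom 1 k * P n)"
      using LINT_poly_mult[of "P n" "monom 1 k"] by (simp add: poly_monom mult.commute)
    also have "\<dots> = (\<Sum>j<Suc k. L (monom 1 k * P j) * L (P n * P j) / h j)"
      by (rule parseval) auto
    also have "\<dots> = 0"
      using that by (intro sum.neutral) (auto simp: OP_orthogonal)
    finally show ?thesis .
  qed
  then show "degree (P n) = n \<and> lead_coeff (P n) = 1 \<and>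
      (\<forall>k<n. (LINT x|lborel. poly (P n) x * x ^ k * w x) = 0)"
    by simp
next
  fix p assume p: "degree p = n \<and> lead_coeff p = 1 \<and>
      (\<forall>k<n. (LINT x|lborel. poly p x * x ^ k * w x) = 0)"
  have orth: "L (p * q) = 0" if "\<And>i. i \<ge> n \<Longrightarrow> coeff q i = 0" for q
  proof -
    have "q = (\<Sum>i<n. smult (coeff q i) (monom 1 i))"
      using that by (intro poly_eqI) (auto simp: coeff_sum if_distrib not_less cong: if_cong)
    then have "L (p * q) = L (\<Sum>i<n. smult (coeff q i) (p * monom 1 i))"
      by (metis (no_types, lifting) mult_smult_right sum.cong sum_distrib_left)
    also have "\<dots> = (\<Sum>i<n. coeff q i * L (p * monom 1 i))"
      by (simp add: moment_functional_sum moment_functional_smult)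
    also have "\<dots> = 0"
      using p by (intro sum.neutral) (auto simp flip: LINT_poly_mult simp: poly_monom)
    finally show ?thesis .
  qed
  define r where "r = p - P n"
  have r0: "coeff r i = 0" if "i \<ge> n" for i
    using p that by (cases "i = n") (auto simp: r_def coeff_eq_0)
  have "L (P n * r) = L (r * P n)" by (simp add: mult.commute)
  also have "\<dots> = 0"
    by (subst parseval[OF r0]) (auto intro!: sum.neutral simp: OP_orthogonal)
  finally have "L (P n * r) = 0" .
  with orth[OF r0] have "L (r * r) = 0"
    by (simp add: r_def left_diff_distrib moment_functional_diff)
  then have "r = 0"
    using moment_functional_pos[of r] by force
  then show "p = P n" by (simp add: r_def)
qed

lemma hOP_eq: "hOP w n = h n"
  unfolding hOP_def monic_OP_eq power2_eq_square LINT_poly_mult OP_norm_def ..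

lemma gammaOP_power2: "(gammaOP w n)\<^sup>2 = \<Gamma> n"
  using OP_norm_pos[of n] OP_norm_pos[of "n - 1"] by (auto simp: gammaOP_def OP_gamma2_def hOP_eq)

lemma betaOP_eq: "betaOP w n = \<beta> n"
  unfolding betaOP_def
proof (rule the_equality)
  have rec: "[:0, 1:] * P n = P (Suc n) + smult (\<beta> n) (P n) + smult (\<Gamma> n) (P (n - 1))"
    using OP_recurrence[of "moments w" n] by (simp add: polyX_def)
  then show "[:0, 1:] * monic_OP w n = monic_OP w (Suc n) + smult (\<beta> n) (monic_OP w n)
      + smult ((gammaOP w n)\<^sup>2) (if n = 0 then 0 else monic_OP w (n - 1))"
    \<comment> \<open>At n = 0 the definition inserts the polynomial 0 where
      \<open>OP_recurrence\<close> has \<open>P 0\<close>; both carry the coefficient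
      \<open>\<Gamma> 0 = 0\<close>.\<close>
    unfolding monic_OP_eq gammaOP_power2 by (cases n) auto
  fix b assume b: "[:0, 1:] * monic_OP w n = monic_OP w (Suc n) + smult b (monic_OP w n)
      + smult ((gammaOP w n)\<^sup>2) (if n = 0 then 0 else monic_OP w (n - 1))"
  then have "smult b (P n) = smult (\<beta> n) (P n)"
    unfolding monic_OP_eq gammaOP_power2 using rec by (cases n) auto
  then have "smult (b - \<beta> n) (P n) = 0"
    by (simp add: smult_diff_left)
  then show "b = \<beta> n"
    by simp
qed

end

section \<open>The Gaussian weight\<close>

lemma
  assumes c: "c > 0"
  shows integrable_gaussian_power: "integrable lborel (\<lambda>x::real. x ^ k * exp (- c * x\<^sup>2))"
    and gaussian_moment_zero: "moments (\<lambda>x. exp (- c * x\<^sup>2)) 0 = sqrt (pi / c)"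
    and gaussian_moment_one: "moments (\<lambda>x. exp (- c * x\<^sup>2)) 1 = 0"
    and gaussian_moment_Suc_Suc: "2 * c * moments (\<lambda>x. exp (- c * x\<^sup>2)) (Suc (Suc k))
      = real (Suc k) * moments (\<lambda>x. exp (- c * x\<^sup>2)) k"
proof -
  \<comment> \<open>Standard deviation of the normal density proportional to
    \<open>exp (- c * x\<^sup>2)\<close>.\<close>
  define \<sigma> where "\<sigma> = 1 / sqrt (2 * c)"
  have \<sigma>: "\<sigma> > 0" and \<sigma>2: "\<sigma>\<^sup>2 = 1 / (2 * c)"
    using c by (simp_all add: \<sigma>_def power_divide)
  have eq: "x ^ k * exp (- c * x\<^sup>2) = sqrt (pi / c) * (normal_density 0 \<sigma> x * (x - 0) ^ k)" for x k
    using c by (simp add: normal_density_def \<sigma>2 real_sqrt_divide field_simps)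
  have ev: "has_bochner_integral lborel (\<lambda>x. x ^ (2 * k) * exp (- c * x\<^sup>2))
     (sqrt (pi / c) * (fact (2 * k) / ((2 / \<sigma>\<^sup>2) ^ k * fact k)))" for k
    unfolding eq by (intro has_bochner_integral_mult_right normal_moment_even \<sigma>)
  have od: "has_bochner_integral lborel (\<lambda>x. x ^ (2 * k + 1) * exp (- c * x\<^sup>2)) (sqrt (pi / c) * 0)" for k
    unfolding eq by (intro has_bochner_integral_mult_right normal_moment_odd \<sigma>)
  show "integrable lborel (\<lambda>x::real. x ^ k * exp (- c * x\<^sup>2))"
    using ev[of "k div 2"] od[of "k div 2"]
    by (cases "even k") (auto simp: has_bochner_integral_iff elim!: evenE oddE)
  have mev: "moments (\<lambda>x. exp (- c * x\<^sup>2)) (2 * k) = sqrt (pi / c) * (fact (2 * k) / ((4 * c) ^ k * fact k))" for k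
    using has_bochner_integral_integral_eq[OF ev[of k]] c by (simp add: moments_def \<sigma>2)
  have mod: "moments (\<lambda>x. exp (- c * x\<^sup>2)) (2 * k + 1) = 0" for k
    using has_bochner_integral_integral_eq[OF od[of k]] by (simp add: moments_def)
  show "moments (\<lambda>x. exp (- c * x\<^sup>2)) 0 = sqrt (pi / c)"
    using mev[of 0] by simp
  show "moments (\<lambda>x. exp (- c * x\<^sup>2)) 1 = 0"
    using mod[of 0] by simp
  show "2 * c * moments (\<lambda>x. exp (- c * x\<^sup>2)) (Suc (Suc k))
      = real (Suc k) * moments (\<lambda>x. exp (- c * x\<^sup>2)) k"
  proof (cases "even k")
    case True
    then obtain j where k: "k = 2 * j" by (elim evenE)
    have "Suc (Suc k) = 2 * Suc j" by (simp add: k)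
    define F K :: real where "F = fact (2 * j)" and "K = (4 * c) ^ j * fact j"
    have "fact (2 * Suc j) = (2 * real j + 2) * ((2 * real j + 1) * F)"
      by (simp add: F_def) (simp add: algebra_simps)
    moreover have "(4 * c) ^ Suc j * fact (Suc j) = 4 * c * (real j + 1) * K"
      by (simp add: K_def algebra_simps)
    moreover have "K \<noteq> 0" using c by (simp add: K_def)
    moreover have "real j + 1 \<noteq> 0" by linarith
    ultimately have "fact (2 * Suc j) / ((4 * c) ^ Suc j * fact (Suc j))
      = (2 * real j + 1) / (2 * c) * (F / K)"
      using c by (simp add: divide_simps)
    then show ?thesis
      unfolding \<open>Suc (Suc k) = 2 * Suc j\<close> unfolding k mev using c by (simp add: F_def K_def)
  next
    case False
    then obtain j where k: "k = 2 * j + 1" by (elim oddE)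
    have "Suc (Suc k) = 2 * Suc j + 1" by (simp add: k)
    then show ?thesis
      unfolding k using mod[of j] mod[of "Suc j"] by simp
  qed
qed

text \<open>\<open>m_Suc_Suc\<close> is integration by parts against exp (- c x^2) for the power
  x^(k+1); \<open>m1\<close> is the same identity for the constant 1.\<close>

locale gaussian_moments = positive_moments +
  fixes c :: real
  assumes c_pos: "c > 0" and m1: "m 1 = 0"
    and m_Suc_Suc: "2 * c * m (Suc (Suc k)) = real (Suc k) * m k"
begin

lemma L_pderiv: "L (pderiv p) = 2 * c * L (polyX * p)"
proof -
  let ?n = "degree p"
  have "L (pderiv p) = (\<Sum>i\<le>?n. coeff (pderiv p) i * m i)"
    by (rule moment_functional_eq_sum) (simp add: degree_pderiv)
  also have "\<dots> = (\<Sum>i\<le>?n. coeff p (Suc i) * (2 * c * m (Suc (Suc i))))"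
    unfolding m_Suc_Suc by (simp add: coeff_pderiv mult_ac)
  also have "\<dots> = 2 * c * (\<Sum>i\<le>?n. coeff p (Suc i) * m (Suc (Suc i)))"
    by (simp add: sum_distrib_left mult_ac)
  also have "(\<Sum>i\<le>?n. coeff p (Suc i) * m (Suc (Suc i))) = (\<Sum>i\<le>Suc (Suc ?n). coeff (polyX * p) i * m i)"
    using m1 by (simp add: sum.atMost_Suc_shift coeff_polyX_mult del: sum.atMost_Suc)
  also have "\<dots> = L (polyX * p)"
    by (rule moment_functional_eq_sum[symmetric]) (rule order.trans[OF degree_mult_le], simp)
  finally show ?thesis .
qed

text \<open>Apply \<open>L_pderiv\<close> to P_(n+1) P_n: the derivative of P_(n+1) has leading
  coefficient n + 1, that of P_n is orthogonal to P_(n+1).\<close>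

lemma gaussian_norm_Suc: "h (Suc n) = real (Suc n) / (2 * c) * h n"
proof -
  have "pderiv (P (Suc n) * P n) = pderiv (P (Suc n)) * P n + pderiv (P n) * P (Suc n)"
    by (simp add: pderiv_mult mult.commute)
  moreover have "L (pderiv (P (Suc n)) * P n) = real (Suc n) * h n"
    by (subst L_OP_lead) (auto simp: coeff_pderiv coeff_eq_0)
  moreover have "L (pderiv (P n) * P (Suc n)) = 0"
    by (subst L_OP_lead) (auto simp: coeff_pderiv coeff_eq_0)
  ultimately have "real (Suc n) * h n = 2 * c * L (polyX * P (Suc n) * P n)"
    using L_pderiv[of "P (Suc n) * P n"] by (simp add: moment_functional_add mult.assoc)
  moreover have "L (polyX * P (Suc n) * P n) = h (Suc n)"
    by (simp add: L_polyX_OP_OP)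
  ultimately show ?thesis
    using c_pos by (simp add: field_simps)
qed

lemma gaussian_norm: "h n = h 0 * fact n / (2 * c) ^ n"
  by (induction n) (simp_all add: gaussian_norm_Suc)

text \<open>Apply \<open>L_pderiv\<close> to x P_n^2; x times the derivative of P_n has leading
  coefficient n.\<close>

lemma gaussian_sq: "sq n n / h n = (2 * real n + 1) / (2 * c)"
proof -
  have eq: "pderiv (polyX * P n * P n) = P n * P n + (polyX * pderiv (P n)) * P n + (polyX * pderiv (P n)) * P n"
    by (simp add: pderiv_mult algebra_simps) (simp add: polyX_def pderiv_pCons)
  have "coeff (polyX * pderiv (P n)) i = real i * coeff (P n) i" for i
    by (cases i) (auto simp: coeff_polyX_mult coeff_pderiv)
  then have "L ((polyX * pderiv (P n)) * P n) = real n * h n"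
    by (subst L_OP_lead) (auto simp: coeff_eq_0)
  then have "L (pderiv (polyX * P n * P n)) = (2 * real n + 1) * h n"
    unfolding eq moment_functional_add by (simp only: OP_orthogonal) (simp add: algebra_simps)
  then have "(2 * real n + 1) * h n = 2 * c * sq n n"
    unfolding L_pderiv by (simp add: OP_sq_def mult.assoc)
  then show ?thesis
    using c_pos by (simp add: field_simps)
qed

end

section \<open>The partition function as a product of norms\<close>

text \<open>Passing from powers to \<open>P i\<close> multiplies by the coefficient matrix, which is
  lower triangular with unit diagonal.\<close>

lemma det_monic_polys:
  fixes P :: "nat \<Rightarrow> 'a :: idom poly"
  assumes deg: "\<And>i. i < n \<Longrightarrow> degree (P i) = i" and lc: "\<And>i. i < n \<Longrightarrow> coeff (P i) i = 1"
  shows "Determinant.det (Matrix.mat n n (\<lambda>(i, j). poly (P i) (z j))) = Determinant.det (Matrix.mat n n (\<lambda>(i, j). z j ^ i))"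
proof -
  let ?A = "Matrix.mat n n (\<lambda>(i, j). coeff (P i) j)"
  let ?V = "Matrix.mat n n (\<lambda>(i, j). z j ^ i)"
  have "Matrix.mat n n (\<lambda>(i, j). poly (P i) (z j)) = ?A * ?V"
  proof (rule eq_matI)
    fix i j assume ij: "i < dim_row (?A * ?V)" "j < dim_col (?A * ?V)"
    then have "poly (P i) (z j) = (\<Sum>k<n. coeff (P i) k * z j ^ k)"
      unfolding poly_altdef using deg[of i]
      by (intro sum.mono_neutral_left) (auto simp: coeff_eq_0)
    then show "Matrix.mat n n (\<lambda>(i, j). poly (P i) (z j)) $$ (i, j) = (?A * ?V) $$ (i, j)"
      using ij by (simp add: scalar_prod_def lessThan_atLeast0)
  qed auto
  then have "Determinant.det (Matrix.mat n n (\<lambda>(i, j). poly (P i) (z j))) = Determinant.det ?A * Determinant.det ?V"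
    by (simp add: det_mult[of _ n])
  moreover have "Determinant.det ?A = 1"
  proof -
    have "Determinant.det ?A = prod_list (diag_mat ?A)"
      by (rule det_lower_triangular[of n]) (use deg in \<open>auto simp: coeff_eq_0\<close>)
    also have "\<dots> = 1"
      unfolding prod_list_diag_prod using lc by (intro prod.neutral) auto
    finally show ?thesis .
  qed
  ultimately show ?thesis by simp
qed

text \<open>The determinant is the same for all monic choices. For the Newton basis with nodes
  \<open>z j\<close> the matrix is triangular, because \<open>Q i\<close> vanishes at
  \<open>z j\<close> for j < i.\<close>

lemma vandermonde_monic:
  fixes P :: "nat \<Rightarrow> 'a :: idom poly"
  assumes "\<And>i. i < n \<Longrightarrow> degree (P i) = i" "\<And>i. i < n \<Longrightarrow> coeff (P i) i = 1"
  shows "Determinant.det (Matrix.mat n n (\<lambda>(i, j). poly (P i) (z j))) = (\<Prod>k<n. \<Prod>j<k. z k - z j)"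
proof -
  define Q where "Q i = (\<Prod>j<i. [:- z j, 1:])" for i
  have Q: "degree (Q i) = i" "coeff (Q i) i = 1" for i
  proof -
    show d: "degree (Q i) = i"
      unfolding Q_def by (subst degree_prod_eq_sum_degree) auto
    have "lead_coeff (Q i) = 1"
      unfolding Q_def by (simp add: lead_coeff_prod)
    then show "coeff (Q i) i = 1" by (simp add: d)
  qed
  let ?M = "Matrix.mat n n (\<lambda>(i, j). poly (Q i) (z j))"
  have "Determinant.det (Matrix.mat n n (\<lambda>(i, j). poly (P i) (z j))) = Determinant.det ?M"
    using det_monic_polys[of n P z] det_monic_polys[of n Q z] assms Q by simp
  also have "\<dots> = prod_list (diag_mat ?M)"
  proof (rule det_upper_triangular[of _ n])
    show "upper_triangular ?M"
      by (rule upper_triangularI) (auto simp: Q_def poly_prod intro!: prod_zero)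
  qed auto
  also have "\<dots> = (\<Prod>k<n. \<Prod>j<k. z k - z j)"
    unfolding prod_list_diag_prod
    by (simp add: Q_def poly_prod lessThan_atLeast0)
  finally show ?thesis .
qed

text \<open>The squared differences are the square of det P_i(z_j). Expanding both determinants over
  permutations gives products of one-variable functions; Fubini and orthogonality leave the n! pairs
  of equal permutations, whose signs square to 1.\<close>

lemma heine_product:
  fixes w :: "real \<Rightarrow> real"
  assumes deg: "\<And>i. i < n \<Longrightarrow> degree (P i) = i" and lc: "\<And>i. i < n \<Longrightarrow> coeff (P i) i = 1"
    and int: "\<And>i j. i < n \<Longrightarrow> j < n \<Longrightarrow> integrable lborel (\<lambda>x. poly (P i) x * poly (P j) x * w x)"
    and orth: "\<And>i j. i < n \<Longrightarrow> j < n \<Longrightarrow>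
       (LINT x|lborel. poly (P i) x * poly (P j) x * w x) = (if i = j then h i else 0)"
  shows "(LINT z|Pi\<^sub>M {..<n} (\<lambda>_. lborel). (\<Prod>k<n. \<Prod>j<k. (z j - z k) ^ 2) * (\<Prod>j<n. w (z j)))
     = fact n * (\<Prod>i<n. h i)"
proof -
  interpret product_sigma_finite "\<lambda>_::nat. lborel :: real measure"
    by standard
  define S where "S = {p. p permutes {..<n}}"
  have fin: "finite S"
    unfolding S_def by (rule finite_permutations) simp
  have lt: "p j < n" if "p \<in> S" "j < n" for p j
    using that permutes_in_image[of p "{..<n}" j] by (simp add: S_def)
  define T where "T p q z = (\<Prod>j<n. poly (P (p j)) (z j) * poly (P (q j)) (z j) * w (z j))"
    for p q :: "nat \<Rightarrow> nat" and z :: "nat \<Rightarrow> real"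
  have eq: "(\<Prod>k<n. \<Prod>j<k. (z j - z k) ^ 2) * (\<Prod>j<n. w (z j))
     = (\<Sum>p\<in>S. \<Sum>q\<in>S. signof p * signof q * T p q z)" for z :: "nat \<Rightarrow> real"
  proof -
    let ?D = "Determinant.det (Matrix.mat n n (\<lambda>(i, j). poly (P i) (z j)))"
    have "(\<Prod>k<n. \<Prod>j<k. (z j - z k) ^ 2) = (\<Prod>k<n. \<Prod>j<k. (z k - z j) ^ 2)"
      by (intro prod.cong refl power2_commute)
    also have "\<dots> = ?D ^ 2"
      by (subst vandermonde_monic) (simp_all only: deg lc prod_power_distrib)
    finally have V: "(\<Prod>k<n. \<Prod>j<k. (z j - z k) ^ 2) = ?D ^ 2" .
    have D: "?D = (\<Sum>p\<in>S. signof p * (\<Prod>j<n. poly (P (p j)) (z j)))"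
      unfolding S_def
      by (subst mat_det_left_def[of _ n]) (auto simp: lessThan_atLeast0 intro!: sum.cong prod.cong)
    have "(\<Prod>k<n. \<Prod>j<k. (z j - z k) ^ 2) =
        (\<Sum>p\<in>S. signof p * (\<Prod>j<n. poly (P (p j)) (z j))) *
        (\<Sum>p\<in>S. signof p * (\<Prod>j<n. poly (P (p j)) (z j)))"
      unfolding V D by (rule power2_eq_square)
    also have "\<dots> = (\<Sum>p\<in>S. \<Sum>q\<in>S. (signof p * (\<Prod>j<n. poly (P (p j)) (z j))) *
           (signof q * (\<Prod>j<n. poly (P (q j)) (z j))))"
      by (rule sum_product)
    finally have "(\<Prod>k<n. \<Prod>j<k. (z j - z k) ^ 2) * (\<Prod>j<n. w (z j))
       = (\<Sum>p\<in>S. \<Sum>q\<in>S. (signof p * (\<Prod>j<n. poly (P (p j)) (z j))) *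
           (signof q * (\<Prod>j<n. poly (P (q j)) (z j))) * (\<Prod>j<n. w (z j)))"
      by (simp only: sum_distrib_right)
    then show ?thesis
      by (simp add: T_def prod.distrib mult_ac)
  qed
  have intT: "integrable (Pi\<^sub>M {..<n} (\<lambda>_. lborel)) (T p q)" if "p \<in> S" "q \<in> S" for p q
    unfolding T_def
    by (rule product_integrable_prod) (use that lt int in auto)
  have "(LINT z|Pi\<^sub>M {..<n} (\<lambda>_. lborel). T p q z) = (if p = q then (\<Prod>i<n. h i) else 0)"
    if "p \<in> S" "q \<in> S" for p q
  proof -
    have "(LINT z|Pi\<^sub>M {..<n} (\<lambda>_. lborel). T p q z)
       = (\<Prod>j<n. LINT x|lborel. poly (P (p j)) x * poly (P (q j)) x * w x)"
      unfolding T_def by (rule product_integral_prod) (use that lt int in auto)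
    also have "\<dots> = (\<Prod>j<n. if p j = q j then h (p j) else 0)"
      using that lt by (intro prod.cong refl orth) auto
    also have "\<dots> = (if p = q then (\<Prod>i<n. h i) else 0)"
    proof (cases "p = q")
      case True
      have "(\<Prod>j<n. h (p j)) = (\<Prod>i<n. h i)"
        using that prod.permute[of p "{..<n}" h] by (simp add: S_def o_def)
      with True show ?thesis by simp
    next
      case False
      then obtain j where "p j \<noteq> q j" by auto
      moreover from this have "j < n"
        using that by (metis S_def lessThan_iff mem_Collect_eq permutes_def)
      ultimately show ?thesis
        using False by (auto intro!: prod_zero)
    qed
    finally show ?thesis .
  qed
  note intTeq = this
  have "(LINT z|Pi\<^sub>M {..<n} (\<lambda>_. lborel). (\<Prod>k<n. \<Prod>j<k. (z j - z k) ^ 2) * (\<Prod>j<n. w (z j)))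
      = (\<Sum>p\<in>S. \<Sum>q\<in>S. signof p * signof q * (LINT z|Pi\<^sub>M {..<n} (\<lambda>_. lborel). T p q z))"
    unfolding eq using intT
    by (subst Bochner_Integration.integral_sum, simp)
      (intro sum.cong refl, subst Bochner_Integration.integral_sum, auto)
  also have "\<dots> = (\<Sum>p\<in>S. \<Prod>i<n. h i)"
  proof (intro sum.cong refl)
    fix p assume p: "p \<in> S"
    have "(\<Sum>q\<in>S. signof p * signof q * (LINT z|Pi\<^sub>M {..<n} (\<lambda>_. lborel). T p q z))
       = (\<Sum>q\<in>S. if q = p then signof p * signof p * (\<Prod>i<n. h i) else 0)"
      using p by (intro sum.cong refl) (auto simp: intTeq)
    also have "\<dots> = (\<Prod>i<n. h i)"
      using p fin by (simp add: sign_def)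
    finally show "(\<Sum>q\<in>S. signof p * signof q * (LINT z|Pi\<^sub>M {..<n} (\<lambda>_. lborel). T p q z)) = \<dots>" .
  qed
  also have "\<dots> = fact n * (\<Prod>i<n. h i)"
    using card_permutations[of "{..<n}" n] by (simp add: S_def)
  finally show ?thesis .
qed

section \<open>The deformed weight and its moments\<close>

text \<open>With a remainder of order two, differentiation under the integral takes one integrated
  inequality and no exchange of limits. The set \<open>S\<close> admits the one-sided derivative at
  s = 0.\<close>

lemma has_real_derivative_quadratic:
  assumes "\<And>y. y \<in> S \<Longrightarrow> \<bar>f y - f x - D * (y - x)\<bar> \<le> K * (y - x)\<^sup>2"
  shows "(f has_real_derivative D) (at x within S)"
  unfolding has_field_derivative_iff
proof (rule LIM_zero_cancel, rule Lim_null_comparison)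
  show "\<forall>\<^sub>F y in at x within S. norm ((f y - f x) / (y - x) - D) \<le> K * \<bar>y - x\<bar>"
    unfolding eventually_at_filter
  proof (intro always_eventually allI impI)
    fix y assume y: "y \<noteq> x" "y \<in> S"
    have "\<bar>(f y - f x) / (y - x) - D\<bar> = \<bar>f y - f x - D * (y - x)\<bar> / \<bar>y - x\<bar>"
      using y by (simp add: field_simps flip: abs_divide)
    also have "\<dots> \<le> K * (y - x)\<^sup>2 / \<bar>y - x\<bar>"
      using assms[OF y(2)] by (intro divide_right_mono) auto
    also have "\<dots> = K * \<bar>y - x\<bar>"
      using y by (simp add: power2_eq_square field_simps flip: abs_mult)
    finally show "norm ((f y - f x) / (y - x) - D) \<le> K * \<bar>y - x\<bar>"
      by simp
  qed
  show "((\<lambda>y. K * \<bar>y - x\<bar>) \<longlongrightarrow> 0) (at x within S)"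
    by (auto intro!: tendsto_eq_intros)
qed

text \<open>The tangent inequality, used from both points, encloses the remainder between 0 and (b -
  a) (exp (- a) - exp (- b)). As a and b are nonnegative, the last factor is at most the distance of
  a and b.\<close>

lemma exp_minus_taylor_bound:
  fixes a b :: real
  assumes "a \<ge> 0" "b \<ge> 0"
  shows "\<bar>exp (- b) - exp (- a) + (b - a) * exp (- a)\<bar> \<le> (b - a)\<^sup>2"
proof -
  have 1: "exp (- b) \<ge> exp (- a) * (1 + (a - b))" for a b :: real
  proof -
    have "exp (- b) = exp (- a) * exp (a - b)"
      by (simp flip: exp_add)
    then show ?thesis
      using exp_ge_add_one_self[of "a - b"] by simp
  qed
  have lip: "\<bar>exp (- a) - exp (- b)\<bar> \<le> \<bar>b - a\<bar>"
  proof -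
    have "exp (- a) - exp (- b) \<le> \<bar>b - a\<bar>" if "a \<ge> 0" "b \<ge> 0" for a b :: real
    proof -
      have "exp (- a) - exp (- b) \<le> exp (- a) * (b - a)"
        using 1[of a b] by (simp add: algebra_simps)
      also have "\<dots> \<le> exp (- a) * \<bar>b - a\<bar>"
        by (intro mult_left_mono) auto
      also have "\<dots> \<le> 1 * \<bar>b - a\<bar>"
        using that by (intro mult_right_mono) auto
      finally show ?thesis by simp
    qed
    from this[of a b] this[of b a] assms show ?thesis by linarith
  qed
  have "0 \<le> exp (- b) - exp (- a) + (b - a) * exp (- a)"
    using 1[of a b] by (simp add: algebra_simps)
  moreover have "exp (- b) - exp (- a) + (b - a) * exp (- a) \<le> (b - a) * (exp (- a) - exp (- b))"
    using 1[of b a] by (simp add: algebra_simps)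
  moreover have "(b - a) * (exp (- a) - exp (- b)) \<le> \<bar>b - a\<bar> * \<bar>b - a\<bar>"
    by (rule order.trans[OF abs_ge_self], unfold abs_mult, rule mult_left_mono[OF lip]) simp
  ultimately show ?thesis
    by (simp add: power2_eq_square)
qed

section \<open>Growth of the potential\<close>

lemma Vpot_lower_bound:
  assumes "d \<ge> 1" "v (2 * d) > 0"
  obtains C where "C \<ge> 0" "\<And>u. Vpot v d u \<ge> - C"
proof -
  define A where "A = v (2 * d)"
  define B where "B = (\<Sum>j=1..<2*d. \<bar>v j\<bar>)"
  \<comment> \<open>Beyond radius \<open>M\<close> the lower-order terms, at most B |u|^(2d-1), do
    not exceed A |u|^(2d); inside, \<open>C\<close> bounds |V|.\<close>
  define M where "M = max 1 (B / A)"
  define C where "C = (\<Sum>j=1..2*d. \<bar>v j\<bar> * M ^ j)"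
  have A: "A > 0" and M: "M \<ge> 1"
    using assms by (auto simp: A_def M_def)
  have C0: "C \<ge> 0"
    unfolding C_def using M by (intro sum_nonneg) auto
  have split: "{1..2 * d} = insert (2 * d) {1..<2 * d}"
    using assms by auto
  have "Vpot v d u \<ge> - C" for u
  proof (cases "\<bar>u\<bar> \<le> M")
    case True
    have "\<bar>Vpot v d u\<bar> \<le> (\<Sum>j=1..2*d. \<bar>v j * u ^ j\<bar>)"
      unfolding Vpot_def by (rule sum_abs)
    also have "\<dots> \<le> C"
      unfolding C_def using True by (intro sum_mono) (auto simp: abs_mult power_abs intro!: mult_left_mono power_mono)
    finally show ?thesis by linarith
  next
    case False
    then have u: "\<bar>u\<bar> \<ge> 1" "B / A \<le> \<bar>u\<bar>"
      by (auto simp: M_def)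
    have "\<bar>\<Sum>j=1..<2*d. v j * u ^ j\<bar> \<le> (\<Sum>j=1..<2*d. \<bar>v j * u ^ j\<bar>)"
      by (rule sum_abs)
    also have "\<dots> \<le> (\<Sum>j=1..<2*d. \<bar>v j\<bar> * \<bar>u\<bar> ^ (2 * d - 1))"
      using u by (intro sum_mono) (auto simp: abs_mult power_abs intro!: mult_left_mono power_increasing)
    also have "\<dots> = B * \<bar>u\<bar> ^ (2 * d - 1)"
      by (simp add: B_def sum_distrib_right)
    also have "\<dots> \<le> (A * \<bar>u\<bar>) * \<bar>u\<bar> ^ (2 * d - 1)"
      using u A by (intro mult_right_mono) (auto simp: field_simps)
    also have "\<dots> = A * \<bar>u\<bar> ^ Suc (2 * d - 1)"
      by (simp add: mult.assoc)
    also have "Suc (2 * d - 1) = 2 * d"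
      using assms by simp
    also have "\<bar>u\<bar> ^ (2 * d) = u ^ (2 * d)"
      by (simp add: power_even_abs)
    finally have "Vpot v d u \<ge> 0"
      unfolding Vpot_def split by (simp add: A_def)
    then show ?thesis using C0 by linarith
  qed
  with C0 show ?thesis by (rule that)
qed

text \<open>Half of the leading term is spent on u^(2d) \<ge> u^2 - 1, while V with the other half
  is still bounded below. This gives integrability at s = 0, where the weight has no Gaussian factor
  of its own.\<close>

lemma Vpot_quadratic_lower_bound:
  assumes "d \<ge> 1" "v (2 * d) > 0"
  obtains \<epsilon> C where "\<epsilon> > 0" "\<And>u. Vpot v d u \<ge> \<epsilon> * u\<^sup>2 - C"
proof -
  define \<epsilon> where "\<epsilon> = v (2 * d) / 2"
  define v' where "v' = v(2 * d := \<epsilon>)"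
  have \<epsilon>: "\<epsilon> > 0" using assms by (simp add: \<epsilon>_def)
  have "v' (2 * d) > 0" using \<epsilon> by (simp add: v'_def)
  from Vpot_lower_bound[of d v', OF \<open>d \<ge> 1\<close> this] obtain C where C: "C \<ge> 0" "\<And>u. Vpot v' d u \<ge> - C"
    by blast
  have split: "{1..2 * d} = insert (2 * d) {1..<2 * d}"
    using assms by auto
  have "Vpot v d u \<ge> \<epsilon> * u\<^sup>2 - (C + \<epsilon>)" for u
  proof -
    have "Vpot v d u = Vpot v' d u + \<epsilon> * u ^ (2 * d)"
      unfolding Vpot_def split by (simp add: v'_def \<epsilon>_def algebra_simps)
    moreover have "u ^ (2 * d) \<ge> u\<^sup>2 - 1"
    proof (cases "\<bar>u\<bar> \<ge> 1")
      case True
      then have "\<bar>u\<bar> ^ 2 \<le> \<bar>u\<bar> ^ (2 * d)"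
        using assms by (intro power_increasing) auto
      then show ?thesis by (simp add: power_even_abs)
    next
      case False
      then have "u\<^sup>2 \<le> 1"
        by (simp add: abs_square_le_1)
      moreover have "u ^ (2 * d) \<ge> 0" by simp
      ultimately show ?thesis by linarith
    qed
    then have "\<epsilon> * u ^ (2 * d) \<ge> \<epsilon> * (u\<^sup>2 - 1)"
      using \<epsilon> by (intro mult_left_mono) auto
    ultimately show ?thesis
      using C(2)[of u] by (simp add: algebra_simps)
  qed
  with \<epsilon> show ?thesis by (rule that)
qed

lemma Vpot_measurable [measurable]: "Vpot v d \<in> borel_measurable borel"
  unfolding Vpot_def[abs_def] by measurable

lemma integrable_abs_gaussian_power:
  assumes "c > 0"
  shows "integrable lborel (\<lambda>x::real. \<bar>x\<bar> ^ k * exp (- c * x\<^sup>2))"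
  using integrable_abs[OF integrable_gaussian_power[OF assms, of k]] by (simp add: abs_mult power_abs)

definition uweight :: "(nat \<Rightarrow> real) \<Rightarrow> nat \<Rightarrow> nat \<Rightarrow> real \<Rightarrow> real \<Rightarrow> real" where
  "uweight v d N s u = exp (- real N * (s * u\<^sup>2 + Vpot v d u))"

locale ensemble =
  fixes v :: "nat \<Rightarrow> real" and d N :: nat
  assumes d: "d \<ge> 1" and v: "v (2 * d) > 0" and N: "N \<ge> 1"
begin

abbreviation "M s \<equiv> moments (uweight v d N s)"

lemma integrable_uweight_abs:
  assumes "s \<ge> 0"
  shows "integrable lborel (\<lambda>u. \<bar>u\<bar> ^ k * uweight v d N s u)"
proof -
  obtain \<epsilon> C where \<epsilon>: "\<epsilon> > 0" "\<And>u. Vpot v d u \<ge> \<epsilon> * u\<^sup>2 - C"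
    using Vpot_quadratic_lower_bound[of d v, OF d v] by blast
  have "integrable lborel (\<lambda>u. exp (real N * C) * (\<bar>u\<bar> ^ k * exp (- (real N * \<epsilon>) * u\<^sup>2)))"
    using \<epsilon> N by (intro integrable_mult_right integrable_abs_gaussian_power) auto
  then show ?thesis
  proof (rule Bochner_Integration.integrable_bound)
    show "(\<lambda>u. \<bar>u\<bar> ^ k * uweight v d N s u) \<in> borel_measurable lborel"
      unfolding uweight_def by measurable
    show "AE u in lborel. norm (\<bar>u\<bar> ^ k * uweight v d N s u)
        \<le> norm (exp (real N * C) * (\<bar>u\<bar> ^ k * exp (- (real N * \<epsilon>) * u\<^sup>2)))"
    proof (rule AE_I2)
      fix u :: real
      have "s * u\<^sup>2 \<ge> 0" using assms by simp
      with \<epsilon>(2)[of u] have "real N * (s * u\<^sup>2 + Vpot v d u) \<ge> real N * (\<epsilon> * u\<^sup>2 - C)"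
        by (intro mult_left_mono) auto
      then have "uweight v d N s u \<le> exp (real N * C + - (real N * \<epsilon>) * u\<^sup>2)"
        unfolding uweight_def by (simp add: algebra_simps)
      then have "uweight v d N s u \<le> exp (real N * C) * exp (- (real N * \<epsilon>) * u\<^sup>2)"
        by (simp only: exp_add)
      then have "\<bar>u\<bar> ^ k * uweight v d N s u \<le> \<bar>u\<bar> ^ k * (exp (real N * C) * exp (- (real N * \<epsilon>) * u\<^sup>2))"
        by (intro mult_left_mono) auto
      then show "norm (\<bar>u\<bar> ^ k * uweight v d N s u)
        \<le> norm (exp (real N * C) * (\<bar>u\<bar> ^ k * exp (- (real N * \<epsilon>) * u\<^sup>2)))"
        by (simp add: uweight_def abs_mult mult_ac)
    qed
  qed
qed

lemma integrable_uweight: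
  assumes "s \<ge> 0"
  shows "integrable lborel (\<lambda>u. u ^ k * uweight v d N s u)"
  by (rule Bochner_Integration.integrable_bound[OF integrable_uweight_abs[OF assms, of k]])
    (auto simp: uweight_def abs_mult power_abs)

lemma moment_weight_uweight: "s \<ge> 0 \<Longrightarrow> moment_weight (uweight v d N s)"
  by unfold_locales (auto simp: integrable_uweight, simp add: uweight_def)

text \<open>With the weight at s = 0 factored out, the remainder is that of exp at arguments a, b
  with b - a = N (s' - s) u^2. Squaring contributes u^4, so the constant is the absolute moment of
  order k + 4 at s = 0, finite and independent of s'.\<close>

lemma DERIV_M:
  assumes s: "s \<ge> 0"
  shows "((\<lambda>s. M s k) has_real_derivative - real N * M s (k + 2)) (at s within {0..})"
proof (rule has_real_derivative_quadratic)
  fix s' :: real assume "s' \<in> {0..}"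
  then have s': "s' \<ge> 0" by simp
  let ?f = "\<lambda>u. u ^ k * uweight v d N s' u - u ^ k * uweight v d N s u
     + real N * (s' - s) * (u ^ (k + 2) * uweight v d N s u)"
  have int: "integrable lborel ?f"
    by (intro Bochner_Integration.integrable_add Bochner_Integration.integrable_diff
       integrable_mult_right integrable_uweight s s')
  have "M s' k - M s k - (- real N * M s (k + 2)) * (s' - s) = (LINT u|lborel. ?f u)"
    using integrable_uweight[OF s] integrable_uweight[OF s']
    by (simp add: moments_def del: power_Suc)
  moreover have "\<bar>LINT u|lborel. ?f u\<bar> \<le>
     (LINT u|lborel. (real N)\<^sup>2 * (s' - s)\<^sup>2 * (\<bar>u\<bar> ^ (k + 4) * uweight v d N 0 u))"
  proof (rule order.trans[OF integral_abs_bound], rule integral_mono)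
    show "integrable lborel (\<lambda>u. \<bar>?f u\<bar>)"
      using int by (rule integrable_abs)
    show "integrable lborel (\<lambda>u. (real N)\<^sup>2 * (s' - s)\<^sup>2 * (\<bar>u\<bar> ^ (k + 4) * uweight v d N 0 u))"
      by (intro integrable_mult_right integrable_uweight_abs) simp
    fix u :: real
    define a b where "a = real N * s * u\<^sup>2" and "b = real N * s' * u\<^sup>2"
    have ab: "a \<ge> 0" "b \<ge> 0"
      using s s' by (auto simp: a_def b_def)
    have w: "uweight v d N s u = uweight v d N 0 u * exp (- a)"
      "uweight v d N s' u = uweight v d N 0 u * exp (- b)"
      by (simp_all add: uweight_def a_def b_def algebra_simps flip: exp_add)
    have ba: "b - a = real N * (s' - s) * u\<^sup>2"
      by (simp add: a_def b_def algebra_simps)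
    have "?f u = u ^ k * uweight v d N 0 u * (exp (- b) - exp (- a) + (b - a) * exp (- a))"
      unfolding w ba by (simp add: algebra_simps power_add power2_eq_square)
    then have "\<bar>?f u\<bar> = \<bar>u\<bar> ^ k * uweight v d N 0 u * \<bar>exp (- b) - exp (- a) + (b - a) * exp (- a)\<bar>"
      by (simp add: abs_mult power_abs uweight_def)
    also have "\<dots> \<le> \<bar>u\<bar> ^ k * uweight v d N 0 u * (b - a)\<^sup>2"
      by (intro mult_left_mono exp_minus_taylor_bound ab) (simp add: uweight_def)
    also have "\<dots> = (real N)\<^sup>2 * (s' - s)\<^sup>2 * (\<bar>u\<bar> ^ (k + 4) * uweight v d N 0 u)"
    proof -
      have "(u\<^sup>2)\<^sup>2 = \<bar>u\<bar> ^ 4"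
        by (simp add: power_even_abs flip: power_mult)
      then show ?thesis
        unfolding ba power_mult_distrib by (simp add: power_add mult_ac)
    qed
    finally show "\<bar>?f u\<bar> \<le> (real N)\<^sup>2 * (s' - s)\<^sup>2 * (\<bar>u\<bar> ^ (k + 4) * uweight v d N 0 u)" .
  qed
  moreover have "(LINT u|lborel. (real N)\<^sup>2 * (s' - s)\<^sup>2 * (\<bar>u\<bar> ^ (k + 4) * uweight v d N 0 u))
      = ((real N)\<^sup>2 * (LINT u|lborel. \<bar>u\<bar> ^ (k + 4) * uweight v d N 0 u)) * (s' - s)\<^sup>2"
    by simp
  ultimately show "\<bar>M s' k - M s k - (- real N * M s (k + 2)) * (s' - s)\<bar> \<le>
      ((real N)\<^sup>2 * (LINT u|lborel. \<bar>u\<bar> ^ (k + 4) * uweight v d N 0 u)) * (s' - s)\<^sup>2"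
    by (simp only:)
qed

lemma tendsto_M: "s \<ge> 0 \<Longrightarrow> ((\<lambda>s. M s k) \<longlongrightarrow> M s k) (at s within {0..})"
  using DERIV_continuous[OF DERIV_M[of s k]] by (simp add: continuous_within)

lemma weight_scale:
  assumes "\<tau> \<ge> 1"
  shows "weight v d N \<tau> (sqrt \<tau> * u) = uweight v d N (\<tau> - 1) u"
proof -
  have "(1 - 1 / \<tau>) * (sqrt \<tau> * u)\<^sup>2 = (\<tau> - 1) * u\<^sup>2"
    using assms by (simp add: power_mult_distrib field_simps)
  then show ?thesis
    using assms by (simp add: weight_def uweight_def Vdef_def)
qed

lemma
  assumes \<tau>: "\<tau> \<ge> 1"
  shows moment_weight_weight: "moment_weight (weight v d N \<tau>)"
    and moments_weight: "moments (weight v d N \<tau>) k = sqrt \<tau> ^ (k + 1) * M (\<tau> - 1) k"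
proof -
  let ?c = "sqrt \<tau>"
  have c: "?c > 0" "?c \<noteq> 0" using \<tau> by auto
  have eq: "(?c * u) ^ k * weight v d N \<tau> (?c * u) = ?c ^ k * (u ^ k * uweight v d N (\<tau> - 1) u)" for u k
    by (simp add: weight_scale[OF \<tau>] power_mult_distrib mult.assoc)
  show "moments (weight v d N \<tau>) k = ?c ^ (k + 1) * M (\<tau> - 1) k"
    unfolding moments_def
    by (subst lborel_integral_real_affine[OF c(2), where t = 0]) (use c eq in simp)
  have "integrable lborel (\<lambda>x. x ^ k * weight v d N \<tau> x)" for k
    using lborel_integrable_real_affine_iff[OF c(2), of "\<lambda>x. x ^ k * weight v d N \<tau> x" 0]
      integrable_uweight[of "\<tau> - 1" k] \<tau> by (simp add: eq)
  then show "moment_weight (weight v d N \<tau>)"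
    by unfold_locales (simp_all add: weight_def)
qed

lemma tendsto_moments_weight:
  "((\<lambda>\<tau>. moments (weight v d N \<tau>) k) \<longlongrightarrow> moments (\<lambda>x. exp (- real N * x\<^sup>2)) k) at_top"
proof -
  obtain C where C: "\<And>u. Vpot v d u \<ge> - C"
    using Vpot_lower_bound[of d v, OF d v] by blast
  show ?thesis
    unfolding moments_def
  proof (rule integral_dominated_convergence_at_top)
    \<comment> \<open>The exponent N / 2 of the majorant comes from 1 - 1/\<tau> \<ge> 1/2 for
      \<tau> \<ge> 2, the factor exp (N C) from the lower bound of V.\<close>
    show "integrable lborel (\<lambda>x. exp (real N * C) * (\<bar>x\<bar> ^ k * exp (- (real N / 2) * x\<^sup>2)))"
      using N by (intro integrable_mult_right integrable_abs_gaussian_power) auto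
    show "\<forall>\<^sub>F \<tau> in at_top. AE x in lborel. norm (x ^ k * weight v d N \<tau> x)
       \<le> exp (real N * C) * (\<bar>x\<bar> ^ k * exp (- (real N / 2) * x\<^sup>2))"
      using eventually_ge_at_top[of 2]
    proof eventually_elim
      case (elim \<tau>)
      show ?case
      proof (rule AE_I2)
        fix x :: real
        have "1 / 2 * x\<^sup>2 \<le> (1 - 1 / \<tau>) * x\<^sup>2"
          using elim by (intro mult_right_mono) (auto simp: field_simps)
        with C[of "x / sqrt \<tau>"] have "1 / 2 * x\<^sup>2 - C \<le> Vdef v d \<tau> x"
          unfolding Vdef_def by linarith
        then have "real N * (1 / 2 * x\<^sup>2 - C) \<le> real N * Vdef v d \<tau> x"
          by (intro mult_left_mono) auto
        then have "weight v d N \<tau> x \<le> exp (real N * C + - (real N / 2) * x\<^sup>2)"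
          unfolding weight_def by (simp add: algebra_simps)
        then have "weight v d N \<tau> x \<le> exp (real N * C) * exp (- (real N / 2) * x\<^sup>2)"
          by (simp only: exp_add)
        then have "\<bar>x\<bar> ^ k * weight v d N \<tau> x \<le> \<bar>x\<bar> ^ k * (exp (real N * C) * exp (- (real N / 2) * x\<^sup>2))"
          by (intro mult_left_mono) auto
        then show "norm (x ^ k * weight v d N \<tau> x)
           \<le> exp (real N * C) * (\<bar>x\<bar> ^ k * exp (- (real N / 2) * x\<^sup>2))"
          by (simp add: weight_def abs_mult power_abs mult_ac)
      qed
    qed
    show "AE x in lborel. ((\<lambda>\<tau>. x ^ k * weight v d N \<tau> x) \<longlongrightarrow> x ^ k * exp (- real N * x\<^sup>2)) at_top"
    proof (rule AE_I2)
      fix x :: real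
      have inv: "((\<lambda>\<tau>::real. 1 / \<tau>) \<longlongrightarrow> 0) at_top"
        by (rule tendsto_divide_0[OF tendsto_const filterlim_at_top_imp_at_infinity[OF filterlim_ident]])
      have sq: "((\<lambda>\<tau>. x / sqrt \<tau>) \<longlongrightarrow> 0) at_top"
        by (rule tendsto_divide_0[OF tendsto_const filterlim_at_top_imp_at_infinity[OF sqrt_at_top]])
      \<comment> \<open>V has no constant term, so the limit weight is exactly exp (- N
        x^2).\<close>
      have "((\<lambda>\<tau>. Vpot v d (x / sqrt \<tau>)) \<longlongrightarrow> (\<Sum>j=1..2*d. v j * 0 ^ j)) at_top"
        unfolding Vpot_def by (intro tendsto_intros sq)
      also have "(\<Sum>j=1..2*d. v j * 0 ^ j) = 0"
        by (intro sum.neutral) auto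
      finally have "((\<lambda>\<tau>. Vdef v d \<tau> x) \<longlongrightarrow> (1 - 0) * x\<^sup>2 + 0) at_top"
        unfolding Vdef_def by (intro tendsto_intros inv)
      then have "((\<lambda>\<tau>. x ^ k * exp (- real N * Vdef v d \<tau> x)) \<longlongrightarrow> x ^ k * exp (- real N * ((1 - 0) * x\<^sup>2 + 0))) at_top"
        by (intro tendsto_intros)
      then show "((\<lambda>\<tau>. x ^ k * weight v d N \<tau> x) \<longlongrightarrow> x ^ k * exp (- real N * x\<^sup>2)) at_top"
        by (simp add: weight_def)
    qed
    show "(\<lambda>x. x ^ k * exp (- real N * x\<^sup>2)) \<in> borel_measurable lborel"
      by measurable
    show "(\<lambda>x. x ^ k * weight v d N \<tau> x) \<in> borel_measurable lborel" for \<tau>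
      unfolding weight_def Vdef_def by measurable
  qed
qed

end

section \<open>The free energy\<close>

text \<open>The exponent of c is the sum of n + 1/2 over n < K, that is K^2 / 2. It is applied with
  c = 2N.\<close>

lemma gauss_partition_product:
  assumes "c > 0"
  shows "(\<Prod>n<K. sqrt (2 * pi / c) * fact n / c ^ n)
    = (2 * pi) powr (real K / 2) / c powr ((real K)\<^sup>2 / 2) * (\<Prod>n<K. fact n)"
proof (induction K)
  case 0
  then show ?case using assms by simp
next
  case (Suc K)
  have "sqrt (2 * pi / c) = (2 * pi) powr (1 / 2) / c powr (1 / 2)"
    using assms by (simp add: powr_half_sqrt real_sqrt_divide)
  moreover have "c ^ K = c powr real K"
    using assms by (simp add: powr_realpow)
  moreover have "(2 * pi) powr (real (Suc K) / 2) = (2 * pi) powr (real K / 2) * (2 * pi) powr (1 / 2)"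
    by (simp add: add_divide_distrib powr_add)
  moreover have "c powr ((real (Suc K))\<^sup>2 / 2) = c powr ((real K)\<^sup>2 / 2) * c powr (1 / 2) * c powr real K"
  proof -
    have "(real (Suc K))\<^sup>2 / 2 = (real K)\<^sup>2 / 2 + 1 / 2 + real K"
      by (simp add: power2_eq_square field_simps)
    then show ?thesis by (simp only: powr_add)
  qed
  ultimately show ?case
    using Suc by (simp add: mult_ac)
qed

text \<open>Absorbs the N! of Heine's formula; the factor for n = 0 is 1.\<close>

lemma prod_fact_shift: "fact K * (\<Prod>n<K. fact n) = (\<Prod>n=1..K. fact n :: real)"
  by (induction K) (simp_all add: mult_ac)

lemma sum_odd_numbers: "(\<Sum>n<K. 2 * real n + 1) = (real K)\<^sup>2"
  by (induction K) (simp_all add: power2_eq_square algebra_simps)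

context ensemble
begin

abbreviation "G \<equiv> moments (\<lambda>x. exp (- real N * x\<^sup>2))"

lemma gaussian_moments_G: "gaussian_moments G (real N)"
proof -
  have N0: "real N > 0" using N by simp
  interpret moment_weight "\<lambda>x. exp (- real N * x\<^sup>2)"
    by unfold_locales (auto intro: integrable_gaussian_power[OF N0, simplified])
  show ?thesis
    using gaussian_moment_one[OF N0] gaussian_moment_Suc_Suc[OF N0] N0 by unfold_locales auto
qed

lemma positive_M: "s \<ge> 0 \<Longrightarrow> positive_moments (M s)"
proof -
  assume "s \<ge> 0"
  then interpret moment_weight "uweight v d N s"
    by (rule moment_weight_uweight)
  show ?thesis
    by unfold_locales
qed

lemma ZN_eq:
  assumes \<tau>: "\<tau> \<ge> 1"
  shows "ZN v d N \<tau> = fact N * (\<Prod>n<N. OP_norm (moments (weight v d N \<tau>)) n)"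
proof -
  interpret moment_weight "weight v d N \<tau>"
    by (rule moment_weight_weight[OF \<tau>])
  have "exp (- real N * (\<Sum>j<N. Vdef v d \<tau> (z j))) = (\<Prod>j<N. weight v d N \<tau> (z j))" for z
    by (simp add: weight_def sum_distrib_left sum_negf exp_sum flip: sum_negf)
  then have "ZN v d N \<tau> = (LINT z|Pi\<^sub>M {..<N} (\<lambda>_. lborel).
      (\<Prod>k<N. \<Prod>j<k. (z j - z k) ^ 2) * (\<Prod>j<N. weight v d N \<tau> (z j)))"
    by (simp only: ZN_def)
  also have "\<dots> = fact N * (\<Prod>n<N. h n)"
  proof (rule heine_product)
    show "integrable lborel (\<lambda>x. poly (P i) x * poly (P j) x * weight v d N \<tau> x)" for i j
      using integrable_poly[of "P i * P j"] by simp
    show "(LINT x|lborel. poly (P i) x * poly (P j) x * weight v d N \<tau> x) = (if i = j then h i else 0)" for i j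
      unfolding LINT_poly_mult by (rule OP_orthogonal)
  qed auto
  finally show ?thesis .
qed

text \<open>The expectation of the sum of the u_j^2, as the trace of x^2 compressed to degree below
  N. The s-derivative of ln (h_0 ... h_(N-1)) is - N times this.\<close>

definition second_moment :: "real \<Rightarrow> real" where
  "second_moment s = (\<Sum>n<N. OP_sq (M s) n n / OP_norm (M s) n)"

lemma weight_dilate:
  assumes \<tau>: "\<tau> \<ge> 1"
  shows "OP_norm (moments (weight v d N \<tau>)) n = sqrt \<tau> ^ (2 * n + 1) * OP_norm (M (\<tau> - 1)) n"
    and "toda_flux (moments (weight v d N \<tau>)) n = \<tau>\<^sup>2 * toda_flux (M (\<tau> - 1)) n"
    and "OP_sq (moments (weight v d N \<tau>)) n n / OP_norm (moments (weight v d N \<tau>)) n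
      = \<tau> * (OP_sq (M (\<tau> - 1)) n n / OP_norm (M (\<tau> - 1)) n)"
proof -
  have c: "sqrt \<tau> \<noteq> 0" using \<tau> by simp
  have 2: "(sqrt \<tau>)\<^sup>2 = \<tau>" using \<tau> by simp
  then have 4: "sqrt \<tau> ^ 4 = \<tau>\<^sup>2" by (metis power2_eq_square power4_eq_xxxx mult.assoc)
  note m = moments_weight[OF \<tau>]
  show "OP_norm (moments (weight v d N \<tau>)) n = sqrt \<tau> ^ (2 * n + 1) * OP_norm (M (\<tau> - 1)) n"
    by (rule OP_norm_dilate[OF c m])
  show "toda_flux (moments (weight v d N \<tau>)) n = \<tau>\<^sup>2 * toda_flux (M (\<tau> - 1)) n"
    using toda_flux_dilate[OF c m] by (simp only: 4)
  show "OP_sq (moments (weight v d N \<tau>)) n n / OP_norm (moments (weight v d N \<tau>)) n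
      = \<tau> * (OP_sq (M (\<tau> - 1)) n n / OP_norm (M (\<tau> - 1)) n)"
    using OP_sq_dilate[OF c m] by (simp only: 2)
qed

text \<open>The scaling exponents (2n + 1)/2 of \<tau> sum to N^2/2. The resulting term - (ln
  \<tau>)/2 of the free energy is the source of the 1/2 in the integrand.\<close>

lemma FN_eq:
  assumes \<tau>: "\<tau> \<ge> 1"
  shows "FN v d N \<tau> = - (ln (fact N) + ((real N)\<^sup>2 / 2 * ln \<tau> + (\<Sum>n<N. ln (OP_norm (M (\<tau> - 1)) n)))) / (real N)\<^sup>2"
proof -
  interpret positive_moments "M (\<tau> - 1)"
    using \<tau> by (intro positive_M) simp
  have sq: "sqrt \<tau> > 0" using \<tau> by simp
  have "ln (ZN v d N \<tau>) = ln (fact N) + (\<Sum>n<N. ln (sqrt \<tau> ^ (2 * n + 1) * h n))"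
    unfolding ZN_eq[OF \<tau>] weight_dilate(1)[OF \<tau>] using sq OP_norm_pos
    by (subst ln_mult_pos) (auto simp: ln_prod intro!: prod_pos)
  also have "(\<Sum>n<N. ln (sqrt \<tau> ^ (2 * n + 1) * h n)) = (\<Sum>n<N. (2 * real n + 1) * (ln \<tau> / 2) + ln (h n))"
  proof (intro sum.cong refl)
    fix n
    have "ln (sqrt \<tau> ^ (2 * n + 1) * h n) = ln (sqrt \<tau> ^ (2 * n + 1)) + ln (h n)"
      using sq OP_norm_pos[of n] by (intro ln_mult_pos) auto
    also have "ln (sqrt \<tau> ^ (2 * n + 1)) = (2 * real n + 1) * (ln \<tau> / 2)"
      using \<tau> by (subst ln_realpow) (auto simp: ln_sqrt)
    finally show "ln (sqrt \<tau> ^ (2 * n + 1) * h n) = (2 * real n + 1) * (ln \<tau> / 2) + ln (h n)" .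
  qed
  also have "\<dots> = (real N)\<^sup>2 * (ln \<tau> / 2) + (\<Sum>n<N. ln (h n))"
    by (simp only: sum.distrib[of "\<lambda>n. (2 * real n + 1) * (ln \<tau> / 2)"] sum_odd_numbers sum_distrib_right[symmetric])
  finally show ?thesis
    by (simp add: FN_def)
qed

text \<open>The factor \<tau>^2 of the rescaled flux cancels the denominator, and what remains is
  \<tau> - t times the second derivative of \<open>FN\<close>.\<close>

lemma integrand_eq:
  assumes \<tau>: "\<tau> \<ge> 1"
  shows "integrand v d N t \<tau> = (\<tau> - t) * (1 / (2 * \<tau>\<^sup>2) - toda_flux (M (\<tau> - 1)) N)"
proof -
  interpret moment_weight "weight v d N \<tau>"
    by (rule moment_weight_weight[OF \<tau>])
  have "integrand v d N t \<tau> = (t - \<tau>) / \<tau>\<^sup>2 * (toda_flux (moments (weight v d N \<tau>)) N - 1 / 2)"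
    by (simp add: integrand_def Let_def gammaOP_power2 betaOP_eq toda_flux_def)
  also have "\<dots> = (\<tau> - t) * (1 / (2 * \<tau>\<^sup>2) - toda_flux (M (\<tau> - 1)) N)"
    unfolding weight_dilate(2)[OF \<tau>] using \<tau> by (simp add: field_simps)
  finally show ?thesis .
qed

section \<open>First and second derivative of the free energy in the interior\<close>

lemma DERIV_M_interior:
  assumes "s > 0"
  shows "((\<lambda>s. M s k) has_real_derivative - real N * M s (k + 2)) (at s)"
proof -
  have "at s within {0..} = at s"
    using assms by (intro at_within_interior) simp
  then show ?thesis
    using DERIV_M[of s k] assms by simp
qed

text \<open>The Toda equations ask for positivity on a neighbourhood, as well as for two-sided
  derivatives of the moments; hence s > 0.\<close>

lemma eventually_positive_M: "s > 0 \<Longrightarrow> eventually (\<lambda>s. positive_moments (M s)) (nhds s)"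
  using eventually_nhds_in_open[of "{0<..}" s] by (auto elim!: eventually_mono intro: positive_M)

lemma DERIV_FN:
  assumes \<tau>: "\<tau> > 1"
  shows "(FN v d N has_real_derivative - (1 / (2 * \<tau>)) + second_moment (\<tau> - 1) / real N) (at \<tau>)"
proof -
  let ?s = "\<tau> - 1"
  have s: "?s > 0" using \<tau> by simp
  interpret positive_moments "M ?s"
    using s by (intro positive_M) simp
  have h': "((\<lambda>\<tau>. OP_norm (M (\<tau> - 1)) n) has_real_derivative - real N * sq n n) (at \<tau>)" for n
  proof -
    have "((\<lambda>s. OP_norm (M s) n) has_real_derivative - real N * sq n n) (at ?s)"
      by (rule DERIV_OP_norm[OF DERIV_M_interior[OF s] eventually_positive_M[OF s]])
    then show ?thesis
      using DERIV_shift[of "\<lambda>s. OP_norm (M s) n" _ \<tau> "- 1"] by simp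
  qed
  have "((\<lambda>\<tau>. - (ln (fact N) + ((real N)\<^sup>2 / 2 * ln \<tau> + (\<Sum>n<N. ln (OP_norm (M (\<tau> - 1)) n)))) / (real N)\<^sup>2)
     has_real_derivative - (0 + ((real N)\<^sup>2 / 2 * (1 / \<tau>) + (\<Sum>n<N. 1 / h n * (- real N * sq n n)))) / (real N)\<^sup>2) (at \<tau>)"
    using \<tau> OP_norm_pos
    by (intro DERIV_cdivide DERIV_minus DERIV_add DERIV_const DERIV_cmult DERIV_ln_divide DERIV_sum
      DERIV_chain2[OF DERIV_ln_divide h']) auto
  also have "- (0 + ((real N)\<^sup>2 / 2 * (1 / \<tau>) + (\<Sum>n<N. 1 / h n * (- real N * sq n n)))) / (real N)\<^sup>2
      = - (1 / (2 * \<tau>)) + second_moment ?s / real N"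
  proof -
    have "(\<Sum>n<N. 1 / h n * (- real N * sq n n)) = - real N * second_moment ?s"
      unfolding second_moment_def sum_distrib_left by (intro sum.cong) auto
    then show ?thesis
      using N by (simp add: field_simps power2_eq_square)
  qed
  finally show ?thesis
  proof (rule DERIV_cong_ev[THEN iffD1, rotated -1])
    show "eventually (\<lambda>x. - (ln (fact N) + ((real N)\<^sup>2 / 2 * ln x + (\<Sum>n<N. ln (OP_norm (M (x - 1)) n)))) / (real N)\<^sup>2
       = FN v d N x) (nhds \<tau>)"
      using eventually_nhds_in_open[of "{1<..}" \<tau>] \<tau>
      by (auto elim!: eventually_mono simp: FN_eq)
  qed auto
qed

text \<open>The flux differences telescope, and the flux at index 0 is 0.\<close>

lemma DERIV_second_moment:
  assumes s: "s > 0"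
  shows "(second_moment has_real_derivative - real N * toda_flux (M s) N) (at s)"
proof -
  have "((\<lambda>s. \<Sum>n<N. OP_sq (M s) n n / OP_norm (M s) n) has_real_derivative
     (\<Sum>n<N. real N * (toda_flux (M s) n - toda_flux (M s) (Suc n)))) (at s)"
    by (intro DERIV_sum DERIV_OP_sq[OF DERIV_M_interior[OF s] eventually_positive_M[OF s]])
  moreover have "(\<Sum>n<N. real N * (toda_flux (M s) n - toda_flux (M s) (Suc n))) = - real N * toda_flux (M s) N"
    unfolding sum_distrib_left[symmetric] sum_lessThan_telescope'
    by (simp add: toda_flux_def)
  ultimately show ?thesis
    by (simp add: second_moment_def[abs_def])
qed

text \<open>Carries continuity up to \<tau> = 1, where s = \<tau> - 1 is at the endpoint 0 and
  limits are one-sided.\<close>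

lemma continuous_on_shift:
  assumes "\<And>s. s \<ge> 0 \<Longrightarrow> (f \<longlongrightarrow> f s) (at s within {0..})" "A \<subseteq> {1..}"
  shows "continuous_on A (\<lambda>\<tau>::real. f (\<tau> - 1) :: real)"
proof -
  have "continuous_on {0..} f"
    using assms(1) by (auto simp: continuous_on_def)
  then show ?thesis
    by (rule continuous_on_compose2) (use assms(2) in \<open>auto intro!: continuous_intros\<close>)
qed

lemma
  assumes "A \<subseteq> {1..}"
  shows continuous_on_norm: "continuous_on A (\<lambda>\<tau>. OP_norm (M (\<tau> - 1)) n)"
    and continuous_on_flux: "continuous_on A (\<lambda>\<tau>. toda_flux (M (\<tau> - 1)) n)"
    and continuous_on_second_moment: "continuous_on A (\<lambda>\<tau>. second_moment (\<tau> - 1))"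
proof -
  show "continuous_on A (\<lambda>\<tau>. OP_norm (M (\<tau> - 1)) n)"
    by (rule continuous_on_shift[OF tendsto_OP_norm[OF tendsto_M positive_M] assms])
  show "continuous_on A (\<lambda>\<tau>. toda_flux (M (\<tau> - 1)) n)"
    by (rule continuous_on_shift[OF tendsto_toda_flux[OF tendsto_M positive_M] assms])
  show "continuous_on A (\<lambda>\<tau>. second_moment (\<tau> - 1))"
  proof (rule continuous_on_shift[OF _ assms])
    fix s :: real assume s: "s \<ge> 0"
    interpret positive_moments "M s" using s by (rule positive_M)
    show "(second_moment \<longlongrightarrow> second_moment s) (at s within {0..})"
      unfolding second_moment_def
      by (intro tendsto_sum tendsto_divide tendsto_OP_sq tendsto_OP_norm tendsto_M positive_M s) simp
  qed
qed

lemma continuous_on_FN: "A \<subseteq> {1..} \<Longrightarrow> continuous_on A (FN v d N)"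
proof -
  assume A: "A \<subseteq> {1..}"
  have "OP_norm (M (\<tau> - 1)) n \<noteq> 0" if "\<tau> \<in> A" for \<tau> n
    using positive_moments.OP_norm_neq_0[OF positive_M, of "\<tau> - 1" n] A that by auto
  moreover have "\<tau> \<noteq> 0" if "\<tau> \<in> A" for \<tau>
    using A that by force
  ultimately have "continuous_on A (\<lambda>\<tau>. - (ln (fact N) + ((real N)\<^sup>2 / 2 * ln \<tau> + (\<Sum>n<N. ln (OP_norm (M (\<tau> - 1)) n)))) / (real N)\<^sup>2)"
    using N by (intro continuous_intros continuous_on_norm A) auto
  then show ?thesis
    by (rule continuous_on_eq) (use A FN_eq in force)
qed

section \<open>Limits at infinity\<close>

lemma tendsto_FN: "(FN v d N \<longlongrightarrow> FGauss N) at_top"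
proof -
  interpret gaussian_moments G "real N" by (rule gaussian_moments_G)
  have N0: "real N > 0" using N by simp
  \<comment> \<open>Left unreduced to fit \<open>gauss_partition_product\<close> with c =
    2N.\<close>
  have h0: "h 0 = sqrt (2 * pi / (2 * real N))"
    using gaussian_moment_zero[OF N0] by (simp add: OP_norm_def OP.simps moment_functional_def)
  have Z: "fact N * (\<Prod>n<N. h n) = (2 * pi) powr (real N / 2) / (2 * real N) powr ((real N)\<^sup>2 / 2)
       * (\<Prod>n=1..N. fact n)"
  proof -
    have "(\<Prod>n<N. h n) = (\<Prod>n<N. sqrt (2 * pi / (2 * real N)) * fact n / (2 * real N) ^ n)"
      by (intro prod.cong refl, subst gaussian_norm) (simp only: h0)
    also have "\<dots> = (2 * pi) powr (real N / 2) / (2 * real N) powr ((real N)\<^sup>2 / 2) * (\<Prod>n<N. fact n)"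
      by (rule gauss_partition_product) (use N0 in simp)
    finally show ?thesis
      unfolding prod_fact_shift[of N, symmetric] by simp
  qed
  have "((\<lambda>\<tau>. fact N * (\<Prod>n<N. OP_norm (moments (weight v d N \<tau>)) n)) \<longlongrightarrow> fact N * (\<Prod>n<N. h n)) at_top"
    by (intro tendsto_mult tendsto_const tendsto_prod tendsto_OP_norm tendsto_moments_weight) unfold_locales
  moreover have "eventually (\<lambda>\<tau>. fact N * (\<Prod>n<N. OP_norm (moments (weight v d N \<tau>)) n) = ZN v d N \<tau>) at_top"
    using eventually_ge_at_top[of 1] by eventually_elim (simp add: ZN_eq)
  ultimately have Z_lim: "(ZN v d N \<longlongrightarrow> fact N * (\<Prod>n<N. h n)) at_top"
    by (rule Lim_transform_eventually)
  have Z_pos: "fact N * (\<Prod>n<N. h n) > 0"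
    by (intro mult_pos_pos prod_pos OP_norm_pos) simp
  have "((\<lambda>\<tau>. - ln (ZN v d N \<tau>) / (real N)\<^sup>2) \<longlongrightarrow> - ln (fact N * (\<Prod>n<N. h n)) / (real N)\<^sup>2) at_top"
    by (intro tendsto_divide tendsto_minus tendsto_ln Z_lim tendsto_const
      less_imp_neq[OF Z_pos, symmetric]) (use N0 in simp)
  then show ?thesis
    unfolding Z by (simp add: FN_def[abs_def] FGauss_def)
qed

text \<open>Since z^2 = \<tau> u^2, the product is the trace of x^2 for the weight in z; for the
  Gaussian weight the entries (2n + 1)/(2N) sum to N/2.\<close>

lemma tendsto_second_moment: "((\<lambda>\<tau>. \<tau> * second_moment (\<tau> - 1)) \<longlongrightarrow> real N / 2) at_top"
proof -
  interpret gaussian_moments G "real N" by (rule gaussian_moments_G)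
  have A: "((\<lambda>\<tau>. \<Sum>n<N. OP_sq (moments (weight v d N \<tau>)) n n / OP_norm (moments (weight v d N \<tau>)) n)
      \<longlongrightarrow> (\<Sum>n<N. sq n n / h n)) at_top"
    by (intro tendsto_sum tendsto_divide tendsto_OP_norm tendsto_OP_sq tendsto_moments_weight
       OP_norm_neq_0 positive_moments_axioms)
  have B: "(\<Sum>n<N. sq n n / h n) = real N / 2"
  proof -
    have "(\<Sum>n<N. sq n n / h n) = (\<Sum>n<N. 2 * real n + 1) / (2 * real N)"
      unfolding gaussian_sq sum_divide_distrib ..
    then show ?thesis
      unfolding sum_odd_numbers using N by (simp add: power2_eq_square)
  qed
  have C: "eventually (\<lambda>\<tau>. (\<Sum>n<N. OP_sq (moments (weight v d N \<tau>)) n n / OP_norm (moments (weight v d N \<tau>)) n)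
      = \<tau> * second_moment (\<tau> - 1)) at_top"
    using eventually_ge_at_top[of 1]
    by eventually_elim (simp add: weight_dilate(3) second_moment_def sum_distrib_left)
  show ?thesis
    using Lim_transform_eventually[OF A C] unfolding B .
qed

text \<open>The derivative of \<open>FN\<close> for \<tau> > 1, by \<open>DERIV_FN\<close>; the
  expression stays continuous at \<tau> = 1.\<close>

definition FN' :: "real \<Rightarrow> real" where
  "FN' \<tau> = - (1 / (2 * \<tau>)) + second_moment (\<tau> - 1) / real N"

lemma continuous_on_integrand: "A \<subseteq> {1..} \<Longrightarrow> continuous_on A (integrand v d N t)"
proof -
  assume A: "A \<subseteq> {1..}"
  have "\<tau> \<noteq> 0" if "\<tau> \<in> A" for \<tau>
    using A that by force
  then have "continuous_on A (\<lambda>\<tau>. (\<tau> - t) * (1 / (2 * \<tau>\<^sup>2) - toda_flux (M (\<tau> - 1)) N))"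
    by (intro continuous_intros continuous_on_flux A) auto
  then show ?thesis
    by (rule continuous_on_eq) (use A integrand_eq in force)
qed

lemma integral_integrand:
  assumes "t \<ge> 1" "T \<ge> t"
  shows "(LBINT \<tau>=t..T. integrand v d N t \<tau>) = (T - t) * FN' T - FN v d N T + FN v d N t"
proof -
  have A: "{t..T} \<subseteq> {1..}" using assms by auto
  \<comment> \<open>Antiderivative obtained by integrating (\<tau> - t) F'' by parts; at \<tau> = t
    only - F survives.\<close>
  define H where "H \<tau> = (\<tau> - t) * FN' \<tau> - FN v d N \<tau>" for \<tau>
  have FN': "(FN' has_real_derivative 1 / (2 * \<tau>\<^sup>2) - toda_flux (M (\<tau> - 1)) N) (at \<tau>)" if "\<tau> > 1" for \<tau>
  proof -
    have "((\<lambda>\<tau>. second_moment (\<tau> - 1)) has_real_derivative - real N * toda_flux (M (\<tau> - 1)) N) (at \<tau>)"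
      using DERIV_second_moment[of "\<tau> - 1"] DERIV_shift[of second_moment _ \<tau> "- 1"] that by simp
    from DERIV_cdivide[OF this, of "real N"]
    have b: "((\<lambda>\<tau>. second_moment (\<tau> - 1) / real N) has_real_derivative - toda_flux (M (\<tau> - 1)) N) (at \<tau>)"
      using N by simp
    have a: "((\<lambda>\<tau>. - (1 / (2 * \<tau>))) has_real_derivative 1 / (2 * \<tau>\<^sup>2)) (at \<tau>)"
      using that by (auto intro!: derivative_eq_intros simp: power2_eq_square)
    show ?thesis
      unfolding FN'_def[abs_def] using DERIV_add[OF a b] by simp
  qed
  \<comment> \<open>The derivative is available for \<tau> > 1 while t = 1 is allowed, hence the
    form with derivatives in the open interval and continuity on the closed one.\<close>
  have "(integrand v d N t has_integral (H T - H t)) {t..T}"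
  proof (rule fundamental_theorem_of_calculus_interior[OF \<open>T \<ge> t\<close>])
    have "\<And>\<tau>. \<tau> \<in> {t..T} \<Longrightarrow> \<tau> \<noteq> 0" using assms by auto
    then show "continuous_on {t..T} H"
      unfolding H_def FN'_def using N
      by (intro continuous_intros continuous_on_second_moment continuous_on_FN A) auto
    fix \<tau> assume "\<tau> \<in> {t<..<T}"
    then have \<tau>: "\<tau> > 1" using assms by auto
    have "(H has_real_derivative (1 - 0) * FN' \<tau> + (1 / (2 * \<tau>\<^sup>2) - toda_flux (M (\<tau> - 1)) N) * (\<tau> - t) - FN' \<tau>) (at \<tau>)"
      unfolding H_def[abs_def]
      by (intro DERIV_diff DERIV_mult DERIV_ident DERIV_const FN' \<tau> DERIV_FN[OF \<tau>, folded FN'_def])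
    moreover have "(1 - 0) * FN' \<tau> + (1 / (2 * \<tau>\<^sup>2) - toda_flux (M (\<tau> - 1)) N) * (\<tau> - t) - FN' \<tau>
        = integrand v d N t \<tau>"
      using \<tau> by (simp add: integrand_eq)
    ultimately show "(H has_vector_derivative integrand v d N t \<tau>) (at \<tau>)"
      by (simp add: has_real_derivative_iff_has_vector_derivative)
  qed
  moreover have "(LBINT \<tau>=t..T. integrand v d N t \<tau>) = integral {t..T} (integrand v d N t)"
    using assms by (intro interval_integral_eq_integral borel_integrable_atLeastAtMost' continuous_on_integrand A)
  ultimately show ?thesis
    by (simp add: integral_unique H_def)
qed

text \<open>The two terms of \<open>FN'\<close> behave like -1/(2T) and 1/(2T). Their leading orders
  cancel, so \<open>FN'\<close> is o(1/T).\<close>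

lemma tendsto_boundary: "((\<lambda>T. (T - t) * FN' T) \<longlongrightarrow> 0) at_top"
proof -
  have inv: "((\<lambda>T::real. t / T) \<longlongrightarrow> 0) at_top"
    by (rule tendsto_divide_0[OF tendsto_const filterlim_at_top_imp_at_infinity[OF filterlim_ident]])
  have "((\<lambda>T. (1 - t / T) * (- (1 / 2) + T * second_moment (T - 1) / real N)) \<longlongrightarrow> (1 - 0) * (- (1 / 2) + real N / 2 / real N)) at_top"
    using N by (intro tendsto_intros inv tendsto_second_moment) auto
  moreover have "eventually (\<lambda>T. (1 - t / T) * (- (1 / 2) + T * second_moment (T - 1) / real N) = (T - t) * FN' T) at_top"
    using eventually_gt_at_top[of 0] 
    by eventually_elim (use N in \<open>simp add: FN'_def field_simps\<close>)
  ultimately show ?thesis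
    using N by (auto intro: Lim_transform_eventually)
qed

end

theorem theorem3p4:
  fixes v :: "nat \<Rightarrow> real" and d N :: nat and t :: real
  assumes "d \<ge> 1" and "v (2 * d) > 0" and "N \<ge> 1" and "t \<ge> 1"
  shows "(\<forall>T\<ge>t. set_integrable lborel {t..T} (integrand v d N t)) \<and>
         ((\<lambda>T::real. LBINT \<tau>=t..T. integrand v d N t \<tau>) \<longlongrightarrow> FN v d N t - FGauss N) at_top"
proof -
  interpret ensemble v d N
    using assms by unfold_locales
  have "((\<lambda>T. (T - t) * FN' T - FN v d N T + FN v d N t) \<longlongrightarrow> 0 - FGauss N + FN v d N t) at_top"
    by (intro tendsto_intros tendsto_boundary tendsto_FN)
  moreover have "eventually (\<lambda>T. (T - t) * FN' T - FN v d N T + FN v d N t = (LBINT \<tau>=t..T. integrand v d N t \<tau>)) at_top"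
    using eventually_ge_at_top[of t] by eventually_elim (simp add: integral_integrand \<open>t \<ge> 1\<close>)
  ultimately have "((\<lambda>T::real. LBINT \<tau>=t..T. integrand v d N t \<tau>) \<longlongrightarrow> 0 - FGauss N + FN v d N t) at_top"
    by (rule Lim_transform_eventually)
  moreover have "set_integrable lborel {t..T} (integrand v d N t)" for T
    using \<open>t \<ge> 1\<close> by (intro borel_integrable_atLeastAtMost' continuous_on_integrand) auto
  ultimately show ?thesis
    by simp
qed

end
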